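(* Let $q$ be a nonzero complex number with $|q|<1$. The following identities are true: \begin{align*} \overline{J}_{1,4}\cdot\phi(q)&=\sum_{n=0}^{\infty}(-1)^{n}q^{2n^2+n}(1+q^{2n+1})\sum_{j=-n}^n(-1)^jq^{-3j^2/2+j/2}\\ &=\Big(\sum_{\substack{n+j\ge0\\ n-j\ge0}}-\sum_{\substack{n+j<0\\ n-j<0}}\Big)(-1)^{n+j}q^{2n^2+n-3j^2/2+j/2}\\ &=f_{1,7,1}(-q,-q^2,q)+q\,f_{1,7,1}(-q^3,-q^4,q),\\[4pt] \overline{J}_{1,4}\cdot\nu(q)&=\sum_{n=0}^{\infty}(-1)^nq^{2n^2+2n}\sum_{j=-n}^n(-1)^jq^{-3j^2/2+j/2}\\ &=\frac12\Big(\sum_{\substack{n+j\ge0\\ n-j\ge0}}-\sum_{\substack{n+j<0\\ n-j<0}}\Big)(-1)^{n+j}q^{2n^2+2n-3j^2/2+j/2},\\[4pt] J_{1,2}\cdot\big(q\,\overline{\phi}_0(q)+1\big)&=\sum_{n=0}^{\infty}q^{4n^2+n}(1-q^{6n+3})\sum_{j=-n}^n(-1)^jq^{-3j^2-j}\\ &=\Big(\sum_{\substack{n+j\ge0\\ n-j\ge0}}-\sum_{\substack{n+j<0\\ n-j<0}}\Big)(-1)^{j}q^{4n^2+n-3j^2-j},\\[4pt] J_{1,2}\cdot\overline{\phi}_1(q)&=\sum_{n=0}^{\infty}q^{4n^2+3n}(1-q^{2n+1})\sum_{j=-n}^n(-1)^jq^{-3j^2-j}\\ &=\Big(\sum_{\substack{n+j\ge0\\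 n-j\ge0}}-\sum_{\substack{n+j<0\\ n-j<0}}\Big)(-1)^{j}q^{4n^2+3n-3j^2-j}. \end{align*}
   Context: Notation: $(x;q)_n:=\prod_{i=0}^{n-1}(1-q^ix)$, $(x;q)_\infty:=\prod_{i\ge0}(1-q^ix)$. Theta functions: $j(x;q):=(x;q)_\infty(q/x;q)_\infty(q;q)_\infty=\sum_{n\in\mathbb{Z}}(-1)^nq^{\binom n2}x^n$; for integers $a,m$ with $m>0$, $J_{a,m}:=j(q^a;q^m)$ and $\overline{J}_{a,m}:=j(-q^a;q^m)$. In the double sums with inequality conditions, $(n,j)$ ranges over pairs of integers satisfying them. Mock theta functions: $$\phi(q):=\sum_{n=0}^{\infty}\frac{q^{n^2}}{(-q^2;q^2)_n},\qquad \nu(q):=\sum_{n=0}^{\infty}\frac{q^{n(n+1)}}{(-q;q^2)_{n+1}},$$ $$\overline{\phi}_0(q):=\sum_{n=0}^{\infty}q^n(-q;q)_{2n+1},\qquad \overline{\phi}_1(q):=\sum_{n=0}^{\infty}q^n(-q;q)_{2n}.$$ Hecke-type double sums: let $\mathrm{sg}(r):=1$ for $r\ge0$ and $\mathrm{sg}(r):=-1$ for $r<0$. For $x,y\in\mathbb{C}\setminus\{0\}$, $$f_{a,b,c}(x,y,q):=\sum_{\substack{r,s\in\mathbb{Z}\\ \mathrm{sg}(r)=\mathrm{sg}(s)}}\mathrm{sg}(r)(-1)^{r+s}x^ry^sq^{a\binom r2+brs+c\binom s2}.$$ *)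

theory Defs
  imports "HOL-Analysis.Analysis"
begin

definition qpoch :: "complex \<Rightarrow> complex \<Rightarrow> nat \<Rightarrow> complex" where
  "qpoch x q n = (\<Prod>i<n. 1 - q ^ i * x)"

definition qpoch_inf :: "complex \<Rightarrow> complex \<Rightarrow> complex" where
  "qpoch_inf x q = (\<Prod>i. 1 - q ^ i * x)"

definition theta_j :: "complex \<Rightarrow> complex \<Rightarrow> complex" where
  "theta_j x q = qpoch_inf x q * qpoch_inf (q / x) q * qpoch_inf q q"

text \<open>The base \<open>q\<close>, implicit in the usual notation \<open>J\<^sub>a\<^sub>,\<^sub>m\<close>, is the last argument here.\<close>

definition theta_J :: "int \<Rightarrow> int \<Rightarrow> complex \<Rightarrow> complex" where
  "theta_J a m q = theta_j (q powi a) (q powi m)"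

definition theta_J_bar :: "int \<Rightarrow> int \<Rightarrow> complex \<Rightarrow> complex" where
  "theta_J_bar a m q = theta_j (- (q powi a)) (q powi m)"

definition mock_phi :: "complex \<Rightarrow> complex" where
  "mock_phi q = (\<Sum>n. q ^ (n ^ 2) / qpoch (- (q ^ 2)) (q ^ 2) n)"

definition mock_nu :: "complex \<Rightarrow> complex" where
  "mock_nu q = (\<Sum>n. q ^ (n * (n + 1)) / qpoch (- q) (q ^ 2) (n + 1))"

definition mock_phi_bar_0 :: "complex \<Rightarrow> complex" where
  "mock_phi_bar_0 q = (\<Sum>n. q ^ n * qpoch (- q) q (2 * n + 1))"

definition mock_phi_bar_1 :: "complex \<Rightarrow> complex" where
  "mock_phi_bar_1 q = (\<Sum>n. q ^ n * qpoch (- q) q (2 * n))"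

text \<open>Unlike the library's \<^const>\<open>sgn\<close>, this sign function takes the value 1 at 0.\<close>

definition sg :: "int \<Rightarrow> complex" where
  "sg r = (if r \<ge> 0 then 1 else - 1)"

text \<open>For integers \<open>r\<close> of either sign, \<open>r * (r - 1) div 2\<close> is an exact division and
  equals the binomial coefficient \<open>r\<close> over 2; all exponents are integers.\<close>

definition hecke_f ::
  "int \<Rightarrow> int \<Rightarrow> int \<Rightarrow> complex \<Rightarrow> complex \<Rightarrow> complex \<Rightarrow> complex" where
  "hecke_f a b c x y q =
     (\<Sum>\<^sub>\<infinity>(r, s)\<in>{(r, s). sg r = sg s}.
        sg r * (- 1) powi (r + s) * x powi r * y powi s *
        q powi (a * (r * (r - 1) div 2) + b * r * s + c * (s * (s - 1) div 2)))"

text \<open>The difference of the sums of \<open>F n j\<close> over all integers with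
  \<open>n + j \<ge> 0\<close>, \<open>n - j \<ge> 0\<close> and over all integers with \<open>n + j < 0\<close>, \<open>n - j < 0\<close>.\<close>

definition cone_sum :: "(int \<Rightarrow> int \<Rightarrow> complex) \<Rightarrow> complex" where
  "cone_sum F =
     (\<Sum>\<^sub>\<infinity>(n, j)\<in>{(n, j). n + j \<ge> 0 \<and> n - j \<ge> 0}. F n j) -
     (\<Sum>\<^sub>\<infinity>(n, j)\<in>{(n, j). n + j < 0 \<and> n - j < 0}. F n j)"

end

theory Submission
  imports Defs
begin

text \<open>
  The inner sums are truncations of the pentagonal series in \<open>1 / p\<close>, with \<open>p = q\<close> or \<open>p = q\<^sup>2\<close>.
  Up to the factor \<open>p^(2 n\<^sup>2 + n)\<close> they equal
  \<open>U n = (\<Sum>k\<le>n. (-1)^k p^(k choose 2) (p;p)_(2n-k) / (p;p)_k)\<close>, because both sides satisfy the same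
  first-order recurrence; in other words, \<open>p^(2 n\<^sup>2 + n) (1 - p^(2n+1))\<close> times the inner sum forms,
  up to normalisation, a Bailey pair with \<open>\<beta> n = 1\<close>. Each single series in the theorem is thus a
  double series over \<open>n\<close> and \<open>k\<close>. After the substitution \<open>n = j + k\<close>, the sum over \<open>k\<close> is evaluated
  by Lebesgue's identity or a signed companion of it, which leaves a single series in \<open>j\<close>. For the
  last two identities this is the definition of the mock theta function; for \<open>\<phi>\<close> and \<open>\<nu>\<close> it is
  the series \<open>\<Sum>j. (q;q\<^sup>2)_j t^j\<close> at \<open>t = - q\<^sup>2\<close> and \<open>t = - q\<close>, whose functional equation in \<open>t\<close>
  brings it to the defining form.
\<close>

subsection \<open>q-Pochhammer symbols\<close>

text \<open>The power of \<open>q\<close> left over once \<open>p^(2 n^2 + n)\<close> is absorbed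
  into \<open>alt_sum\<close> decides the difficulty. For \<open>mock_nu\<close> and
  \<open>mock_phi_bar_1\<close> it is \<open>q^n\<close>, so the double series converges absolutely
  and can be rearranged at once. For \<open>mock_phi\<close> nothing is left, and for
  \<open>mock_phi_bar_0\<close> it is \<open>q^(-n)\<close>: convergence then rests on cancellation
  inside \<open>alt_sum\<close>, and terms have to be combined before the order of summation is
  changed. Putting \<open>n = j + k\<close> turns \<open>(p;p)_(2n-k)\<close> into
  \<open>(p;p)_(2j) (p^(2j+1);p)_k\<close>, so every row over \<open>k\<close> is a combination of
  values of one family, \<open>Phi\<close>. In the first two identities the outer
  \<open>(-1)^n\<close> cancels the \<open>(-1)^k\<close> of \<open>alt_sum\<close>; in the last two
  there is no outer sign and \<open>(-1)^k\<close> survives, which is why a signed companion of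
  Lebesgue's identity in base \<open>q^2\<close> is required.\<close>

lemma Suc_choose_two: "Suc k choose 2 = (k choose 2) + k"
  by (simp add: numeral_2_eq_2)

lemma qpoch_0 [simp]: "qpoch x q 0 = 1"
  by (simp add: qpoch_def)

lemma qpoch_Suc: "qpoch x q (Suc n) = qpoch x q n * (1 - q ^ n * x)"
  by (simp add: qpoch_def)

lemma qpoch_add: "qpoch x q (m + n) = qpoch x q m * qpoch (q ^ m * x) q n"
  by (induction n) (simp_all add: qpoch_Suc power_add mult_ac)

lemma qpoch_Suc_left: "qpoch x q (Suc n) = (1 - x) * qpoch (q * x) q n"
  using qpoch_add[of x q 1 n] by (simp add: qpoch_Suc)

lemma qpoch_split_parity: "qpoch x q (2 * n) = qpoch x (q ^ 2) n * qpoch (q * x) (q ^ 2) n"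
  by (induction n) (simp_all add: qpoch_Suc power_mult mult_ac flip: power_mult)

lemma qpoch_mult_minus: "qpoch x q n * qpoch (- x) q n = qpoch (x ^ 2) (q ^ 2) n"
  by (induction n) (simp_all add: qpoch_Suc power_mult power2_eq_square algebra_simps)

lemma one_minus_power_neq_0:
  fixes p :: complex
  assumes "norm p < 1" "n > 0"
  shows "1 - p ^ n \<noteq> 0"
proof
  assume "1 - p ^ n = 0"
  hence "norm (p ^ n) = 1" by simp
  moreover have "norm p ^ n < 1" using assms by (simp add: power_less_one_iff)
  ultimately show False by (simp add: norm_power)
qed

lemma one_plus_power_neq_0:
  fixes p :: complex
  assumes "norm p < 1" "n > 0"
  shows "1 + p ^ n \<noteq> 0"
proof
  assume "1 + p ^ n = 0"
  hence "p ^ n = -1" by (metis add.inverse_unique)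
  hence "norm (p ^ n) = 1" by simp
  moreover have "norm p ^ n < 1" using assms by (simp add: power_less_one_iff)
  ultimately show False by (simp add: norm_power)
qed

lemma qpoch_self_neq_0:
  assumes "norm p < 1"
  shows "qpoch p p n \<noteq> 0"
  using one_minus_power_neq_0[OF assms, of "Suc _"] unfolding qpoch_def
  by (simp add: mult.commute)

lemma convergent_prod_qpoch:
  fixes x q :: complex
  assumes "norm q < 1"
  shows "convergent_prod (\<lambda>i. 1 - q ^ i * x)"
proof -
  have "summable (\<lambda>i. norm ((1 - q ^ i * x) - 1))"
    using assms by (auto simp: norm_mult norm_power intro!: summable_mult2 summable_geometric)
  thus ?thesis
    using abs_convergent_prod_imp_convergent_prod abs_convergent_prod_conv_summable by blast
qed

lemma qpoch_tendsto:
  assumes "norm q < 1"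
  shows "qpoch x q \<longlonglongrightarrow> qpoch_inf x q"
proof -
  have "(\<lambda>n. qpoch x q (Suc n)) \<longlonglongrightarrow> qpoch_inf x q"
    using convergent_prod_LIMSEQ[OF convergent_prod_qpoch[OF assms, of x]]
    by (simp add: qpoch_def qpoch_inf_def lessThan_Suc_atMost)
  thus ?thesis by (rule LIMSEQ_imp_Suc)
qed

lemma qpoch_inf_split:
  assumes "norm q < 1"
  shows "qpoch_inf x q = qpoch x q n * qpoch_inf (q ^ n * x) q"
proof (rule LIMSEQ_unique)
  show "(\<lambda>m. qpoch x q (n + m)) \<longlonglongrightarrow> qpoch_inf x q"
    using LIMSEQ_ignore_initial_segment[OF qpoch_tendsto[OF assms, of x], of n]
    by (simp add: add.commute)
  show "(\<lambda>m. qpoch x q (n + m)) \<longlonglongrightarrow> qpoch x q n * qpoch_inf (q ^ n * x) q"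
    unfolding qpoch_add by (intro tendsto_intros qpoch_tendsto assms)
qed

lemma qpoch_inf_self_neq_0:
  assumes "norm p < 1"
  shows "qpoch_inf p p \<noteq> 0"
  unfolding qpoch_inf_def using one_minus_power_neq_0[OF assms, of "Suc _"]
  by (intro prodinf_nonzero convergent_prod_qpoch assms) (simp add: mult.commute)

lemma norm_power2_less_1:
  fixes q :: complex
  assumes "norm q < 1"
  shows "norm (q ^ 2) < 1"
  using assms by (simp add: norm_power power_less_one_iff)

lemma qpoch_inf_split_parity:
  assumes "norm q < 1"
  shows "qpoch_inf x q = qpoch_inf x (q ^ 2) * qpoch_inf (q * x) (q ^ 2)"
proof (rule LIMSEQ_unique)
  show "(\<lambda>m. qpoch x q (2 * m)) \<longlonglongrightarrow> qpoch_inf x q"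
    by (rule filterlim_compose[OF qpoch_tendsto[OF assms]]) (auto intro: mult_nat_left_at_top)
  show "(\<lambda>m. qpoch x q (2 * m)) \<longlonglongrightarrow> qpoch_inf x (q ^ 2) * qpoch_inf (q * x) (q ^ 2)"
    unfolding qpoch_split_parity by (intro tendsto_intros qpoch_tendsto norm_power2_less_1 assms)
qed

lemma qpoch_inf_mult_minus:
  assumes "norm q < 1"
  shows "qpoch_inf x q * qpoch_inf (- x) q = qpoch_inf (x ^ 2) (q ^ 2)"
proof (rule LIMSEQ_unique)
  show "(\<lambda>m. qpoch x q m * qpoch (- x) q m) \<longlonglongrightarrow> qpoch_inf x q * qpoch_inf (- x) q"
    by (intro tendsto_intros qpoch_tendsto assms)
  show "(\<lambda>m. qpoch x q m * qpoch (- x) q m) \<longlonglongrightarrow> qpoch_inf (x ^ 2) (q ^ 2)"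
    unfolding qpoch_mult_minus by (intro tendsto_intros qpoch_tendsto norm_power2_less_1 assms)
qed

text \<open>By the triangle inequality each factor is at most \<open>1 + norm p ^ i\<close>. The
  majorant is itself a Pochhammer symbol, \<open>(-1; |p|)_n\<close>, which converges; hence one
  bound serves all \<open>a\<close> in the unit disc and all lengths.\<close>

lemma qpoch_bounded:
  assumes "norm p < 1"
  obtains B where "\<And>a n. norm a \<le> 1 \<Longrightarrow> norm (qpoch a p n) \<le> B"
proof -
  define r where "r = complex_of_real (norm p)"
  have "Bseq (qpoch (-1) r)"
    using assms by (intro convergent_imp_Bseq convergentI[OF qpoch_tendsto]) (simp add: r_def)
  then obtain B where B: "\<And>n. norm (qpoch (-1) r n) \<le> B"
    by (auto simp: Bseq_def)
  have "norm (qpoch a p n) \<le> B" if a: "norm a \<le> 1" for a n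
  proof -
    have "norm (qpoch a p n) = (\<Prod>i<n. norm (1 - p ^ i * a))"
      by (simp add: qpoch_def prod_norm)
    also have "\<dots> \<le> (\<Prod>i<n. 1 + norm p ^ i)"
    proof (intro prod_mono conjI norm_ge_zero)
      fix i
      have "norm (1 - p ^ i * a) \<le> 1 + norm p ^ i * norm a"
        using norm_triangle_ineq4[of 1 "p ^ i * a"] by (simp add: norm_mult norm_power)
      also have "\<dots> \<le> 1 + norm p ^ i"
        using a by (simp add: mult_left_le)
      finally show "norm (1 - p ^ i * a) \<le> 1 + norm p ^ i" .
    qed
    also have "\<dots> = norm (\<Prod>i<n. 1 + r ^ i)"
    proof -
      have "(\<Prod>i<n. 1 + r ^ i) = of_real (\<Prod>i<n. 1 + norm p ^ i)"
        by (simp add: r_def)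
      moreover have "(\<Prod>i<n. 1 + norm p ^ i) \<ge> 0"
        by (intro prod_nonneg) auto
      ultimately show ?thesis by (metis abs_of_nonneg norm_of_real)
    qed
    also have "\<dots> = norm (qpoch (-1) r n)"
      by (simp add: qpoch_def)
    finally show ?thesis using B[of n] by linarith
  qed
  thus ?thesis by (rule that)
qed

text \<open>The denominators tend to a nonzero limit, so their inverses are bounded. The two lengths
  are independent because the quotients to be estimated have the shape
  \<open>(p;p)_(2j+k) / (p;p)_k\<close>.\<close>

lemma qpoch_ratio_bounded:
  assumes "norm p < 1"
  obtains B where "B > 0" "\<And>a m n. norm a \<le> 1 \<Longrightarrow> norm (qpoch a p m / qpoch p p n) \<le> B"
proof -
  obtain B where B: "\<And>a n. norm a \<le> 1 \<Longrightarrow> norm (qpoch a p n) \<le> B"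
    by (rule qpoch_bounded[OF assms]) blast
  have "(\<lambda>n. inverse (qpoch p p n)) \<longlonglongrightarrow> inverse (qpoch_inf p p)"
    by (intro tendsto_intros qpoch_tendsto qpoch_inf_self_neq_0 assms)
  hence "Bseq (\<lambda>n. inverse (qpoch p p n))"
    by (intro convergent_imp_Bseq convergentI)
  then obtain C where C: "C > 0" "\<And>n. norm (inverse (qpoch p p n)) \<le> C"
    by (auto simp: Bseq_def)
  have "B \<ge> 1" using B[of 0 0] by simp
  show ?thesis
  proof (rule that)
    show "B * C > 0" using \<open>B \<ge> 1\<close> C by simp
    fix a m n assume "norm (a::complex) \<le> 1"
    hence "norm (qpoch a p m) * norm (inverse (qpoch p p n)) \<le> B * C"
      by (intro mult_mono B C) (use \<open>B \<ge> 1\<close> in auto)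
    thus "norm (qpoch a p m / qpoch p p n) \<le> B * C"
      by (simp add: norm_mult norm_inverse divide_inverse)
  qed
qed

subsection \<open>Lebesgue's identity and its companions\<close>

text \<open>The confluent basic hypergeometric series 1phi1(a; 0; p, -z); the quadratic exponent
  makes it converge for every \<open>z\<close>.\<close>

definition Phi :: "complex \<Rightarrow> complex \<Rightarrow> complex \<Rightarrow> complex" where
  "Phi a z p = (\<Sum>k. p ^ (k choose 2) * z ^ k * (qpoch a p k / qpoch p p k))"

lemma summable_power_choose_two:
  fixes r R :: real
  assumes "0 \<le> r" "r < 1" "0 \<le> R"
  shows "summable (\<lambda>k. r ^ (k choose 2) * R ^ k)"
proof -
  have "(\<lambda>k. r ^ k * R) \<longlonglongrightarrow> 0 * R"
    using assms by (intro tendsto_intros LIMSEQ_realpow_zero) auto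
  hence "eventually (\<lambda>k. r ^ k * R < 1 / 2) sequentially"
    by (rule order_tendstoD) simp
  then obtain N where N: "\<And>k. k \<ge> N \<Longrightarrow> r ^ k * R < 1 / 2"
    by (auto simp: eventually_sequentially)
  show ?thesis
  proof (rule summable_ratio_test)
    show "(1 / 2 :: real) < 1" by simp
    fix k assume "k \<ge> N"
    have "norm (r ^ (Suc k choose 2) * R ^ Suc k) = (r ^ k * R) * (r ^ (k choose 2) * R ^ k)"
      using assms by (simp add: Suc_choose_two power_add mult_ac)
    also have "\<dots> \<le> 1 / 2 * (r ^ (k choose 2) * R ^ k)"
      using N[OF \<open>k \<ge> N\<close>] assms by (intro mult_right_mono) auto
    finally show "norm (r ^ (Suc k choose 2) * R ^ Suc k) \<le> 1 / 2 * norm (r ^ (k choose 2) * R ^ k)"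
      using assms by simp
  qed
qed

lemma norm_Phi_term_le:
  assumes "\<And>a m n. norm a \<le> 1 \<Longrightarrow> norm (qpoch a p m / qpoch p p n) \<le> B" "norm a \<le> 1"
    and "norm z \<le> R"
  shows "norm (p ^ (k choose 2) * z ^ k * (qpoch a p k / qpoch p p k))
           \<le> norm p ^ (k choose 2) * R ^ k * B"
proof -
  have "norm z ^ k \<le> R ^ k" using assms(3) by (intro power_mono) auto
  moreover have "R \<ge> 0" using assms(3) norm_ge_zero order_trans by blast
  ultimately show ?thesis
    unfolding norm_mult norm_power by (intro mult_mono assms) auto
qed

lemma summable_Phi:
  assumes "norm p < 1" "norm a \<le> 1"
  shows "summable (\<lambda>k. p ^ (k choose 2) * z ^ k * (qpoch a p k / qpoch p p k))"
proof -
  obtain B where B: "\<And>a m n. norm a \<le> 1 \<Longrightarrow> norm (qpoch a p m / qpoch p p n) \<le> B"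
    by (rule qpoch_ratio_bounded[OF assms(1)]) blast
  have "summable (\<lambda>k. norm p ^ (k choose 2) * norm z ^ k * B)"
    by (intro summable_mult2 summable_power_choose_two) (use assms in auto)
  thus ?thesis
    by (rule summable_comparison_test'[of _ 0]) (intro norm_Phi_term_le B assms order_refl)
qed

text \<open>Tannery's theorem with the majorant \<open>|p|^(k choose 2) R^k B\<close>. This gives
  the limit whenever a functional equation of \<open>Phi\<close> is iterated with \<open>a\<close>
  or \<open>z\<close> tending to 0.\<close>

lemma Phi_tendsto:
  fixes a z :: "nat \<Rightarrow> complex"
  assumes "norm p < 1" "a \<longlonglongrightarrow> a'" "z \<longlonglongrightarrow> z'" "\<And>n. norm (a n) \<le> 1" "\<And>n. norm (z n) \<le> R"
  shows "(\<lambda>n. Phi (a n) (z n) p) \<longlonglongrightarrow> Phi a' z' p"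
proof -
  obtain B where B: "\<And>a m n. norm a \<le> 1 \<Longrightarrow> norm (qpoch a p m / qpoch p p n) \<le> B"
    by (rule qpoch_ratio_bounded[OF assms(1)]) blast
  have "R \<ge> 0" using assms(5)[of 0] norm_ge_zero order_trans by blast
  hence "summable (\<lambda>k. norm p ^ (k choose 2) * R ^ k * B)"
    by (intro summable_mult2 summable_power_choose_two) (use assms in auto)
  moreover have "eventually (\<lambda>(k, n). norm (p ^ (k choose 2) * z n ^ k * (qpoch (a n) p k / qpoch p p k))
           \<le> norm p ^ (k choose 2) * R ^ k * B) (at_top \<times>\<^sub>F sequentially)"
    using norm_Phi_term_le[OF B assms(4,5)] by (intro always_eventually) auto
  moreover have "(\<lambda>n. p ^ (k choose 2) * z n ^ k * (qpoch (a n) p k / qpoch p p k))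
      \<longlonglongrightarrow> p ^ (k choose 2) * z' ^ k * (qpoch a' p k / qpoch p p k)" for k
    unfolding qpoch_def by (intro tendsto_intros assms) (use qpoch_self_neq_0[OF assms(1)] in \<open>simp add: qpoch_def\<close>)
  ultimately show ?thesis
    unfolding Phi_def using tannerys_theorem by fastforce
qed

text \<open>Subtracting the series at \<open>z * p\<close> inserts \<open>1 - p^k\<close>, which
  kills the term \<open>k = 0\<close> and otherwise cancels the last factor of
  \<open>(p;p)_k\<close>; shifting \<open>k\<close> by one gives the right-hand side.\<close>

lemma Phi_shift_z:
  assumes p: "norm p < 1" and a: "norm a \<le> 1"
  shows "Phi a z p - Phi a (z * p) p = z * (1 - a) * Phi (a * p) (z * p) p"
proof -
  have pa: "norm (a * p) \<le> 1"
    using p a by (simp add: norm_mult mult_le_one)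
  have *: "p ^ (Suc k choose 2) * z ^ Suc k * (qpoch a p (Suc k) / qpoch p p (Suc k)) -
        p ^ (Suc k choose 2) * (z * p) ^ Suc k * (qpoch a p (Suc k) / qpoch p p (Suc k)) =
        z * (1 - a) * (p ^ (k choose 2) * (z * p) ^ k * (qpoch (a * p) p k / qpoch p p k))" for k
  proof -
    have "1 - p ^ Suc k \<noteq> 0" by (rule one_minus_power_neq_0) (use p in auto)
    hence "(1 - p ^ Suc k) * (qpoch a p (Suc k) / qpoch p p (Suc k)) =
            (1 - a) * (qpoch (a * p) p k / qpoch p p k)"
      by (simp add: qpoch_Suc[of p] qpoch_Suc_left[of a] mult_ac)
    moreover have "p ^ (Suc k choose 2) * z ^ Suc k * Q - p ^ (Suc k choose 2) * (z * p) ^ Suc k * Q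
      = p ^ (k choose 2) * z * (z * p) ^ k * ((1 - p ^ Suc k) * Q)" for Q
      by (simp add: Suc_choose_two power_add power_mult_distrib algebra_simps)
    ultimately have "p ^ (Suc k choose 2) * z ^ Suc k * (qpoch a p (Suc k) / qpoch p p (Suc k)) -
        p ^ (Suc k choose 2) * (z * p) ^ Suc k * (qpoch a p (Suc k) / qpoch p p (Suc k)) =
        p ^ (k choose 2) * z * (z * p) ^ k * ((1 - a) * (qpoch (a * p) p k / qpoch p p k))"
      by (simp only:)
    thus ?thesis by (simp add: mult_ac)
  qed
  have s: "summable (\<lambda>k. p ^ (k choose 2) * z ^ k * (qpoch a p k / qpoch p p k) -
        p ^ (k choose 2) * (z * p) ^ k * (qpoch a p k / qpoch p p k))"
    by (intro summable_diff summable_Phi p a)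
  have "Phi a z p - Phi a (z * p) p =
        (\<Sum>k. p ^ (k choose 2) * z ^ k * (qpoch a p k / qpoch p p k) -
        p ^ (k choose 2) * (z * p) ^ k * (qpoch a p k / qpoch p p k))"
    unfolding Phi_def by (intro suminf_diff summable_Phi p a)
  also have "\<dots> = (\<Sum>k. z * (1 - a) * (p ^ (k choose 2) * (z * p) ^ k * (qpoch (a * p) p k / qpoch p p k)))"
    unfolding * [symmetric] using suminf_split_head[OF s] by simp
  also have "\<dots> = z * (1 - a) * Phi (a * p) (z * p) p"
    unfolding Phi_def by (intro suminf_mult summable_Phi p pa)
  finally show ?thesis .
qed

text \<open>The combination inserts \<open>1 - a p^k\<close>, which extends \<open>(a;p)_k\<close>
  to \<open>(a;p)_(k+1) = (1 - a) (a p;p)_k\<close>; no shift of \<open>k\<close> is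
  involved.\<close>

lemma Phi_shift_a:
  assumes p: "norm p < 1" and a: "norm a \<le> 1"
  shows "Phi a z p - a * Phi a (z * p) p = (1 - a) * Phi (a * p) z p"
proof -
  have pa: "norm (a * p) \<le> 1"
    using p a by (simp add: norm_mult mult_le_one)
  have *: "p ^ (k choose 2) * z ^ k * (qpoch a p k / qpoch p p k) -
        a * (p ^ (k choose 2) * (z * p) ^ k * (qpoch a p k / qpoch p p k)) =
        (1 - a) * (p ^ (k choose 2) * z ^ k * (qpoch (a * p) p k / qpoch p p k))" for k
  proof -
    have "(1 - p ^ k * a) * qpoch a p k = (1 - a) * qpoch (a * p) p k"
      using qpoch_Suc[of a p k] qpoch_Suc_left[of a p k] by (simp add: mult_ac)
    moreover have "p ^ (k choose 2) * z ^ k * (Q / R) - a * (p ^ (k choose 2) * (z * p) ^ k * (Q / R))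
      = p ^ (k choose 2) * z ^ k * (((1 - p ^ k * a) * Q) / R)" for Q R
      by (simp add: power_mult_distrib algebra_simps diff_divide_distrib)
    ultimately have "p ^ (k choose 2) * z ^ k * (qpoch a p k / qpoch p p k) -
        a * (p ^ (k choose 2) * (z * p) ^ k * (qpoch a p k / qpoch p p k)) =
        p ^ (k choose 2) * z ^ k * ((1 - a) * qpoch (a * p) p k / qpoch p p k)"
      by (simp only:)
    thus ?thesis by (simp add: mult_ac)
  qed
  have "Phi a z p - a * Phi a (z * p) p = (\<Sum>k. p ^ (k choose 2) * z ^ k * (qpoch a p k / qpoch p p k) -
        a * (p ^ (k choose 2) * (z * p) ^ k * (qpoch a p k / qpoch p p k)))"
    unfolding Phi_def suminf_mult[OF summable_Phi[OF p a], symmetric]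
    by (intro suminf_diff summable_mult summable_Phi p a)
  also have "\<dots> = (1 - a) * Phi (a * p) z p"
    unfolding * Phi_def by (intro suminf_mult summable_Phi p pa)
  finally show ?thesis .
qed

lemma Phi_0_right [simp]: "Phi a 0 p = 1"
  unfolding Phi_def by (subst suminf_finite[of "{0}"]) (auto simp: binomial_eq_0)

lemma power_mult_tendsto_0:
  fixes p x :: complex
  assumes "norm p < 1"
  shows "(\<lambda>n. x * p ^ n) \<longlonglongrightarrow> 0"
  using tendsto_mult[OF tendsto_const LIMSEQ_power_zero[OF assms], of x] by simp

lemma norm_power_mult_le:
  fixes p x :: complex
  assumes "norm p < 1"
  shows "norm (x * p ^ n) \<le> norm x"
  using assms by (simp add: norm_mult norm_power mult_left_le power_le_one)

text \<open>Euler's series for the infinite product. At \<open>a = 0\<close> the shift in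
  \<open>z\<close> closes up to a first-order recurrence with factor \<open>1 + z\<close>, which is
  iterated until the argument has shrunk to 0.\<close>

lemma Phi_zero_left:
  assumes p: "norm p < 1"
  shows "Phi 0 z p = qpoch_inf (- z) p"
proof (rule LIMSEQ_unique)
  have eq: "Phi 0 z p = qpoch (- z) p n * Phi 0 (z * p ^ n) p" for n
  proof (induction n)
    case (Suc n)
    have "Phi 0 (z * p ^ n) p = (1 + z * p ^ n) * Phi 0 (z * p ^ Suc n) p"
      using Phi_shift_z[OF p, of 0 "z * p ^ n"] by (simp add: algebra_simps)
    thus ?case using Suc by (simp add: qpoch_Suc mult_ac)
  qed simp_all
  show "(\<lambda>n. qpoch (- z) p n * Phi 0 (z * p ^ n) p) \<longlonglongrightarrow> Phi 0 z p"
    unfolding eq[symmetric] by (rule tendsto_const)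
  have "(\<lambda>n. qpoch (- z) p n * Phi 0 (z * p ^ n) p) \<longlonglongrightarrow> qpoch_inf (- z) p * Phi 0 0 p"
    by (intro tendsto_intros qpoch_tendsto Phi_tendsto[where R = "norm z"] p power_mult_tendsto_0 norm_power_mult_le) auto
  thus "(\<lambda>n. qpoch (- z) p n * Phi 0 (z * p ^ n) p) \<longlonglongrightarrow> qpoch_inf (- z) p" by simp
qed

text \<open>Contiguous relations give a recurrence under \<open>a\<close> to \<open>a p^2\<close>.
  Iterating it builds \<open>(a p; p^2)_\<infinity>\<close> and drives \<open>a\<close> to 0, where
  Euler's series supplies the other product.\<close>

lemma Lebesgue_identity:
  assumes p: "norm p < 1" and a: "norm a < 1"
  shows "Phi a p p = qpoch_inf (a * p) (p ^ 2) * qpoch_inf (- p) p"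
proof (rule LIMSEQ_unique)
  have step: "Phi a p p = (1 - a * p) * Phi (a * p ^ 2) p p" if a: "norm a < 1" for a
  proof -
    have pa: "norm (a * p) \<le> 1"
      using p a by (simp add: norm_mult mult_le_one)
    have "a \<noteq> 1" using a by auto
    \<comment> \<open>The auxiliary values at \<open>z = 1\<close> are eliminated: the first two
      relations give \<open>Phi a p p\<close> as \<open>Phi (a * p) 1 p - Phi (a * p) p p\<close>,
      up to the factor \<open>1 - a\<close>, and the third evaluates that difference.\<close>
    have "Phi a 1 p - Phi a p p = (1 - a) * Phi (a * p) p p"
         "Phi a 1 p - a * Phi a p p = (1 - a) * Phi (a * p) 1 p"
         "Phi (a * p) 1 p - Phi (a * p) p p = (1 - a * p) * Phi (a * p ^ 2) p p"
      using Phi_shift_z[OF p, of a 1] Phi_shift_a[OF p, of a 1] Phi_shift_z[OF p, of "a * p" 1] pa a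
      by (simp_all add: power2_eq_square mult_ac)
    hence "(1 - a) * Phi a p p = (1 - a) * ((1 - a * p) * Phi (a * p ^ 2) p p)"
      by algebra
    thus ?thesis using \<open>a \<noteq> 1\<close> by simp
  qed
  have p2: "norm (p ^ 2) < 1" by (rule norm_power2_less_1[OF p])
  have eq: "Phi a p p = qpoch (a * p) (p ^ 2) n * Phi (a * (p ^ 2) ^ n) p p" for n
  proof (induction n)
    case (Suc n)
    have "Phi (a * (p ^ 2) ^ n) p p = (1 - a * (p ^ 2) ^ n * p) * Phi (a * (p ^ 2) ^ n * p ^ 2) p p"
      by (rule step) (use norm_power_mult_le[OF p2, of a n] a in linarith)
    thus ?case using Suc by (simp add: qpoch_Suc mult_ac)
  qed simp_all
  show "(\<lambda>n. qpoch (a * p) (p ^ 2) n * Phi (a * (p ^ 2) ^ n) p p) \<longlonglongrightarrow> Phi a p p"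
    unfolding eq[symmetric] by (rule tendsto_const)
  have "(\<lambda>n. qpoch (a * p) (p ^ 2) n * Phi (a * (p ^ 2) ^ n) p p)
          \<longlonglongrightarrow> qpoch_inf (a * p) (p ^ 2) * Phi 0 p p"
    by (intro tendsto_intros qpoch_tendsto Phi_tendsto[where R = "norm p"] p p2
         power_mult_tendsto_0 order_trans[OF norm_power_mult_le[OF p2]]) (use a in auto)
  thus "(\<lambda>n. qpoch (a * p) (p ^ 2) n * Phi (a * (p ^ 2) ^ n) p p)
          \<longlonglongrightarrow> qpoch_inf (a * p) (p ^ 2) * qpoch_inf (- p) p"
    using Phi_zero_left[OF p, of p] by simp
qed

text \<open>The differences \<open>Phi a 1 p - Phi a p p\<close> and
  \<open>Phi a p p - a * Phi a (p ^ 2) p\<close> have the same value, one by the shift in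
  \<open>z\<close> and one by the shift in \<open>a\<close>; so the sum is twice Lebesgue's.\<close>

lemma Lebesgue_companion:
  assumes p: "norm p < 1" and a: "norm a < 1"
  shows "Phi a 1 p + a * Phi a (p ^ 2) p = 2 * qpoch_inf (a * p) (p ^ 2) * qpoch_inf (- p) p"
proof -
  have "Phi a 1 p - Phi a p p = (1 - a) * Phi (a * p) p p"
       "Phi a p p - a * Phi a (p ^ 2) p = (1 - a) * Phi (a * p) p p"
    using Phi_shift_z[OF p, of a 1] Phi_shift_a[OF p, of a p] a by (simp_all add: power2_eq_square)
  hence "Phi a 1 p + a * Phi a (p ^ 2) p = 2 * Phi a p p" by algebra
  thus ?thesis using Lebesgue_identity[OF p a] by simp
qed

text \<open>Taking \<open>a = s^2\<close> in base \<open>q^2\<close> makes a shift of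
  \<open>a\<close> correspond to \<open>s\<close> going to \<open>s q\<close>. Under it the values
  at \<open>-q\<close> and \<open>-q^3\<close> satisfy a two-by-two system, and the combination with
  weight \<open>s\<close> is the one that decouples, with factor \<open>1 - s\<close>. As
  \<open>s\<close> tends to 0, Euler's series leaves \<open>(q;q^2)_\<infinity>\<close>.\<close>

lemma Lebesgue_signed:
  assumes q: "norm q < 1" and s: "norm s < 1"
  shows "Phi (s ^ 2) (- q) (q ^ 2) - s * Phi (s ^ 2) (- (q ^ 3)) (q ^ 2) = qpoch_inf s q * qpoch_inf q (q ^ 2)"
proof (rule LIMSEQ_unique)
  define F where "F s = Phi (s ^ 2) (- q) (q ^ 2) - s * Phi (s ^ 2) (- (q ^ 3)) (q ^ 2)" for s
  have q2: "norm (q ^ 2) < 1" by (rule norm_power2_less_1[OF q])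
  have step: "F s = (1 - s) * F (s * q)" if s: "norm s < 1" for s
  proof -
    have s2: "norm (s ^ 2) < 1" by (rule norm_power2_less_1[OF s])
    have "1 + s \<noteq> 0"
      using one_plus_power_neq_0[OF s, of 1] by simp
    have "Phi (s ^ 2) (- q) (q ^ 2) - Phi (s ^ 2) (- (q ^ 3)) (q ^ 2)
            = - q * (1 - s ^ 2) * Phi ((s * q) ^ 2) (- (q ^ 3)) (q ^ 2)"
         "Phi (s ^ 2) (- q) (q ^ 2) - s ^ 2 * Phi (s ^ 2) (- (q ^ 3)) (q ^ 2)
            = (1 - s ^ 2) * Phi ((s * q) ^ 2) (- q) (q ^ 2)"
      using Phi_shift_z[OF q2, of "s ^ 2" "- q"] Phi_shift_a[OF q2, of "s ^ 2" "- q"] s2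
      by (simp_all add: power_mult_distrib power2_eq_square power3_eq_cube mult_ac)
    \<comment> \<open>The second relation plus \<open>s\<close> times the first; the factor
      \<open>1 - s^2\<close> on the right then splits.\<close>
    hence "(1 + s) * F s = (1 + s) * ((1 - s) * F (s * q))"
      unfolding F_def by algebra
    thus ?thesis using \<open>1 + s \<noteq> 0\<close> by simp
  qed
  have eq: "F s = qpoch s q n * F (s * q ^ n)" for n
  proof (induction n)
    case (Suc n)
    have "F (s * q ^ n) = (1 - s * q ^ n) * F (s * q ^ n * q)"
      by (rule step) (use norm_power_mult_le[OF q, of s n] s in linarith)
    thus ?case using Suc by (simp add: qpoch_Suc mult_ac)
  qed simp_all
  show "(\<lambda>n. qpoch s q n * F (s * q ^ n)) \<longlonglongrightarrow>
          Phi (s ^ 2) (- q) (q ^ 2) - s * Phi (s ^ 2) (- (q ^ 3)) (q ^ 2)"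
    unfolding F_def[of s, symmetric] eq[symmetric] by (rule tendsto_const)
  have lim: "(\<lambda>n. (s * q ^ n) ^ 2) \<longlonglongrightarrow> 0 ^ 2"
    by (intro tendsto_intros power_mult_tendsto_0 q)
  have nrm: "norm ((s * q ^ n) ^ 2) \<le> 1" for n
    using norm_power_mult_le[OF q, of s n] s by (simp add: norm_power abs_square_le_1)
  have "(\<lambda>n. qpoch s q n * F (s * q ^ n)) \<longlonglongrightarrow>
     qpoch_inf s q * (Phi (0 ^ 2) (- q) (q ^ 2) - 0 * Phi (0 ^ 2) (- (q ^ 3)) (q ^ 2))"
    unfolding F_def
    by (intro tendsto_intros qpoch_tendsto Phi_tendsto[where R = "1"] q q2 lim nrm power_mult_tendsto_0)
       (use q in \<open>auto simp: norm_power power_le_one\<close>)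
  thus "(\<lambda>n. qpoch s q n * F (s * q ^ n)) \<longlonglongrightarrow> qpoch_inf s q * qpoch_inf q (q ^ 2)"
    using Phi_zero_left[OF q2, of "- q"] by simp
qed

subsection \<open>Truncated pentagonal sums\<close>

definition alt_sum :: "complex \<Rightarrow> nat \<Rightarrow> complex" where
  "alt_sum p n = (\<Sum>k\<le>n. (- 1) ^ k * p ^ (k choose 2) * (qpoch p p (2 * n - k) / qpoch p p k))"

text \<open>Indefinite summation: the terms of
  \<open>alt_sum p (Suc N) - p^(4N+3) * alt_sum p N\<close> have partial sums in closed form. Only
  \<open>i = N\<close> is used later; a general upper limit is what makes induction
  possible.\<close>

lemma alt_sum_telescope:
  assumes p: "norm p < 1" and "i \<le> N"
  shows "(\<Sum>k\<le>i. (- 1) ^ k * p ^ (k choose 2) *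
           ((qpoch p p (2 * N + 2 - k) - p ^ (4 * N + 3) * qpoch p p (2 * N - k)) / qpoch p p k))
         = (- 1) ^ Suc i * p ^ (Suc i choose 2) * (qpoch p p (2 * N - i) / qpoch p p i) *
             (p ^ (2 * N + 2) - 1 + p ^ (2 * N + 1 - i))"
  using \<open>i \<le> N\<close>
proof (induction i)
  case 0
  define y D where "y = p ^ (2 * N)" and "D = qpoch p p (2 * N)"
  have "4 * N + 3 = 2 * N + 2 * N + 3" by simp
  hence e: "p ^ (4 * N + 3) = y * y * p ^ 3"
    by (simp only: power_add y_def)
  have e': "p ^ (2 * N + 2) = y * p ^ 2" "p ^ (2 * N + 1) = y * p"
    by (simp_all add: y_def power_add power2_eq_square)
  have e'': "qpoch p p (2 * N + 2) = D * (1 - y * p) * (1 - y * p ^ 2)"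
    by (simp add: numeral_2_eq_2 qpoch_Suc D_def y_def mult_ac)
  have "(\<Sum>k\<le>0. (- 1) ^ k * p ^ (k choose 2) *
           ((qpoch p p (2 * N + 2 - k) - p ^ (4 * N + 3) * qpoch p p (2 * N - k)) / qpoch p p k))
     = qpoch p p (2 * N + 2) - p ^ (4 * N + 3) * D"
    by (simp add: binomial_eq_0 D_def)
  also have "\<dots> = - D * (y * p ^ 2 - 1 + y * p)"
    unfolding e e'' by algebra
  also have "\<dots> = (- 1) ^ Suc 0 * p ^ (Suc 0 choose 2) * (qpoch p p (2 * N - 0) / qpoch p p 0) *
             (p ^ (2 * N + 2) - 1 + p ^ (2 * N + 1 - 0))"
    unfolding diff_zero e' by (simp add: binomial_eq_0 D_def)
  finally show ?case .
next
  case (Suc i)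
  \<comment> \<open>With \<open>d = 2N - i - 1\<close> every truncated subtraction becomes an
    addition, and the claim reduces to a polynomial identity in \<open>p\<close>, \<open>P\<close>
    and \<open>y\<close>.\<close>
  obtain d where d: "2 * N = i + 1 + d" using Suc.prems by (metis Suc_eq_plus1 le_Suc_ex mult_2 trans_le_add1)
  define c y P D E where "c = (- 1) ^ Suc i * p ^ (Suc i choose 2)" and "y = p ^ d"
    and "P = p ^ Suc i" and "D = qpoch p p d" and "E = qpoch p p (Suc i)"
  have nz: "1 - P \<noteq> 0" unfolding P_def by (rule one_minus_power_neq_0) (use p in auto)
  have "4 * N + 3 = Suc i + Suc i + d + d + 3" using d by simp
  hence e1: "p ^ (4 * N + 3) = P ^ 2 * y ^ 2 * p ^ 3"
    by (simp only: power_add P_def y_def power2_eq_square mult_ac)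
  have e2: "p ^ (2 * N + 2) = P * y * p ^ 2"
    unfolding d by (simp add: P_def y_def power_add power2_eq_square mult_ac)
  have e3: "qpoch p p (2 * N + 2 - Suc i) = D * (1 - p * y) * (1 - p ^ 2 * y)"
    unfolding d by (simp add: D_def y_def qpoch_Suc power2_eq_square mult_ac)
  have e4: "qpoch p p (2 * N - Suc i) = D" "qpoch p p (2 * N - i) = D * (1 - p * y)"
    unfolding d by (simp_all add: D_def y_def qpoch_Suc mult_ac)
  have e5: "p ^ (2 * N + 1 - i) = p ^ 2 * y" "p ^ (2 * N + 1 - Suc i) = p * y"
    unfolding d by (simp_all add: y_def power2_eq_square Suc_diff_le)
  have e6: "1 / qpoch p p i = (1 - P) / E"
    using nz by (simp add: E_def P_def qpoch_Suc mult_ac)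
  have e7: "(- 1) ^ Suc (Suc i) * p ^ (Suc (Suc i) choose 2) = - c * P"
    by (simp add: c_def P_def Suc_choose_two[of "Suc i"] power_add)
  have "(\<Sum>k\<le>Suc i. (- 1) ^ k * p ^ (k choose 2) *
           ((qpoch p p (2 * N + 2 - k) - p ^ (4 * N + 3) * qpoch p p (2 * N - k)) / qpoch p p k))
     = c * (D * (1 - p * y) * (1 / qpoch p p i)) * (P * y * p ^ 2 - 1 + p ^ 2 * y)
       + c * ((D * (1 - p * y) * (1 - p ^ 2 * y) - P ^ 2 * y ^ 2 * p ^ 3 * D) / E)"
    using Suc unfolding sum.atMost_Suc e1 e2 e3 e4 e5 by (simp add: c_def E_def)
  also have "\<dots> = (c * D / E) * ((1 - p * y) * (1 - P) * (P * y * p ^ 2 - 1 + p ^ 2 * y)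
       + ((1 - p * y) * (1 - p ^ 2 * y) - P ^ 2 * y ^ 2 * p ^ 3))"
    unfolding e6 by (simp add: algebra_simps diff_divide_distrib add_divide_distrib)
  also have "\<dots> = (c * D / E) * (- P * (P * y * p ^ 2 - 1 + p * y))"
    by (rule arg_cong[where f = "(*) (c * D / E)"]) algebra
  also have "\<dots> = (- 1) ^ Suc (Suc i) * p ^ (Suc (Suc i) choose 2) * (qpoch p p (2 * N - Suc i) / qpoch p p (Suc i)) *
             (p ^ (2 * N + 2) - 1 + p ^ (2 * N + 1 - Suc i))"
    unfolding e2 e4 e5 e7 E_def[symmetric] by simp
  finally show ?case .
qed

text \<open>The term \<open>k = N + 1\<close> has Pochhammer quotient 1 and contributes
  \<open>?c\<close>; the rest telescopes. The inhomogeneous part matches the two entries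
  \<open>j = N + 1\<close> and \<open>j = -(N + 1)\<close> that are new in the pentagonal
  sum.\<close>

lemma alt_sum_Suc:
  assumes p: "norm p < 1"
  shows "alt_sum p (Suc N) = p ^ (4 * N + 3) * alt_sum p N
           + (- 1) ^ Suc N * p ^ (Suc N choose 2) * p ^ Suc N * (1 + p ^ Suc N)"
proof -
  let ?c = "(- 1) ^ Suc N * p ^ (Suc N choose 2)"
  have nz: "qpoch p p k \<noteq> 0" for k by (rule qpoch_self_neq_0[OF p])
  have "alt_sum p (Suc N) - p ^ (4 * N + 3) * alt_sum p N = ?c +
      (\<Sum>k\<le>N. (- 1) ^ k * p ^ (k choose 2) *
           ((qpoch p p (2 * N + 2 - k) - p ^ (4 * N + 3) * qpoch p p (2 * N - k)) / qpoch p p k))"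
    using nz[of "Suc N"] unfolding alt_sum_def sum.atMost_Suc sum_distrib_left
    by (simp add: sum_subtractf[symmetric] algebra_simps diff_divide_distrib)
  also have "\<dots> = ?c + ?c * (p ^ (2 * N + 2) - 1 + p ^ Suc N)"
    unfolding alt_sum_telescope[OF p order_refl] using nz[of N] by (simp add: mult_2)
  also have "p ^ (2 * N + 2) = p ^ Suc N * p ^ Suc N"
    by (simp flip: power_add add: mult_2)
  finally show ?thesis by (simp add: algebra_simps)
qed

text \<open>After \<open>n = j + k\<close> the rows contain \<open>(p;p)_(2j+1+k)\<close>; this
  yields the Pochhammer symbols of odd length in \<open>mock_phi_bar_0\<close>.\<close>

definition odd_alt_sum :: "complex \<Rightarrow> nat \<Rightarrow> complex" where
  "odd_alt_sum p n = (\<Sum>k\<le>n. (- 1) ^ k * p ^ (k choose 2) * (qpoch p p (2 * n + 1 - k) / qpoch p p k))"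

text \<open>The identity holds term by term once index \<open>k + 1\<close> of the first sum is
  paired with index \<open>k\<close> of the second. The last summand is the boundary term at
  \<open>k = n + 1\<close>, one beyond the range of \<open>odd_alt_sum\<close>.\<close>

lemma alt_sum_diff:
  assumes p: "norm p < 1"
  shows "alt_sum p (Suc n) - p ^ (2 * n + 1) * alt_sum p n =
     (1 - p ^ (2 * n + 2)) * odd_alt_sum p n + (1 + p ^ Suc n) * (- 1) ^ Suc n * p ^ (Suc n choose 2)"
proof -
  have nz: "qpoch p p k \<noteq> 0" for k by (rule qpoch_self_neq_0[OF p])
  define t where "t k = (- 1) ^ k * p ^ (k choose 2) * (qpoch p p (2 * Suc n - k) / qpoch p p k)" for k
  define u where "u k = (- 1) ^ k * p ^ (k choose 2) * (qpoch p p (2 * n - k) / qpoch p p k)" for k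
  define r where "r k = (- 1) ^ k * p ^ (k choose 2) * (qpoch p p (2 * n + 1 - k) / qpoch p p k)" for k
  have 0: "t 0 = (1 - p ^ (2 * n + 2)) * r 0"
    by (simp add: t_def r_def binomial_eq_0 qpoch_Suc mult_ac)
  have step: "t (Suc i) - p ^ (2 * n + 1) * u i = (1 - p ^ (2 * n + 2)) * r (Suc i)" if "i \<le> n" for i
  proof -
    define d where "d = 2 * n - i"
    have d: "2 * n = d + i" using that by (simp add: d_def)
    define D where "D = qpoch p p d"
    have nz1: "1 - p ^ Suc i \<noteq> 0" by (rule one_minus_power_neq_0) (use p in auto)
    have e1: "qpoch p p (2 * Suc n - Suc i) = D * (1 - p ^ d * p)" "qpoch p p (2 * n - i) = D"
             "qpoch p p (2 * n + 1 - Suc i) = D"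
      using d by (simp_all add: D_def qpoch_Suc Suc_diff_le)
    have e2: "1 / qpoch p p i = (1 - p ^ Suc i) / qpoch p p (Suc i)"
      using nz1 by (simp add: qpoch_Suc mult_ac)
    have e3: "p ^ (2 * n + 1) = p ^ d * p ^ i * p" "p ^ (2 * n + 2) = p ^ d * p ^ i * p * p"
      unfolding d by (simp_all add: power_add)
    have "- s * (C * K) * (D * (1 - Y * p) * Q) - Y * K * p * (s * C * (D * ((1 - p * K) * Q))) =
        (1 - Y * K * p * p) * (- s * (C * K) * (D * Q))" for s C K Y Q :: complex
      by algebra
    from this[of "(- 1) ^ i" "p ^ (i choose 2)" "p ^ i" "p ^ d" "1 / qpoch p p (Suc i)"]
    show ?thesis
      using e2 unfolding t_def u_def r_def e1 e3 unfolding Suc_choose_two power_add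
      by (simp add: divide_inverse)
  qed
  have "t 0 + (\<Sum>i\<le>n. t (Suc i)) - p ^ (2 * n + 1) * (\<Sum>i\<le>n. u i) =
        t 0 + (\<Sum>i\<le>n. t (Suc i) - p ^ (2 * n + 1) * u i)"
    by (simp add: sum_subtractf sum_distrib_left)
  also have "(\<Sum>i\<le>n. t (Suc i) - p ^ (2 * n + 1) * u i) = (\<Sum>i\<le>n. (1 - p ^ (2 * n + 2)) * r (Suc i))"
    by (intro sum.cong step) auto
  also have "t 0 + \<dots> = (1 - p ^ (2 * n + 2)) * (\<Sum>i\<le>Suc n. r i)"
    unfolding sum.atMost_Suc_shift 0 by (simp only: sum_distrib_left distrib_left)
  also have "\<dots> = (1 - p ^ (2 * n + 2)) * (\<Sum>i\<le>n. r i) + (1 - p ^ (2 * n + 2)) * r (Suc n)"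
    by (simp add: algebra_simps)
  \<comment> \<open>At the boundary the quotient is \<open>(p;p)_n / (p;p)_(n+1)\<close>, so the
    factor \<open>1 - p^(n+1)\<close> of \<open>1 - p^(2n+2)\<close> cancels and
    \<open>1 + p^(n+1)\<close> remains.\<close>
  also have "(1 - p ^ (2 * n + 2)) * r (Suc n) = (1 + p ^ Suc n) * (- 1) ^ Suc n * p ^ (Suc n choose 2)"
  proof -
    have nz1: "1 - p ^ Suc n \<noteq> 0" by (rule one_minus_power_neq_0) (use p in auto)
    have "p ^ (2 * n + 2) = p ^ Suc n * p ^ Suc n"
      by (simp flip: power_add add: mult_2)
    moreover have "1 - a * a = (1 + a) * (1 - a)" for a :: complex
      by (simp add: algebra_simps)
    ultimately have "1 - p ^ (2 * n + 2) = (1 + p ^ Suc n) * (1 - p ^ Suc n)"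
      by (simp only:)
    moreover have "(1 - p ^ Suc n) * (qpoch p p (2 * n + 1 - Suc n) / qpoch p p (Suc n)) = 1"
      using nz1 nz[of n] by (simp add: qpoch_Suc mult_2 mult_ac)
    hence "(1 - p ^ Suc n) * r (Suc n) = (- 1) ^ Suc n * p ^ (Suc n choose 2)"
      unfolding r_def by (metis mult.left_commute mult.right_neutral)
    ultimately show ?thesis by (simp only: mult.assoc)
  qed
  finally show ?thesis
    unfolding alt_sum_def odd_alt_sum_def sum.atMost_Suc_shift[of _ n]
    by (simp only: t_def u_def r_def)
qed

definition pent_sum :: "complex \<Rightarrow> nat \<Rightarrow> complex" where
  "pent_sum p n = (\<Sum>j = - int n..int n. (- 1) powi j * p powi ((- 3 * j ^ 2 + j) div 2))"

lemma sum_symmetric_Suc: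
  fixes f :: "int \<Rightarrow> 'a :: comm_monoid_add"
  shows "(\<Sum>j = - int (Suc n)..int (Suc n). f j) = (\<Sum>j = - int n..int n. f j) + (f (int (Suc n)) + f (- int (Suc n)))"
proof -
  have "{- int (Suc n)..int (Suc n)} = insert (int (Suc n)) (insert (- int (Suc n)) {- int n..int n})"
    by auto
  thus ?thesis by (simp add: add_ac)
qed

lemma int_choose_two: "2 * int (m choose 2) = int m * (int m - 1)"
  by (induction m) (simp_all add: Suc_choose_two binomial_eq_0 algebra_simps)

lemma power_mult_powi:
  fixes p :: complex
  assumes "p \<noteq> 0" "int a + e = int b"
  shows "p ^ a * p powi e = p ^ b"
proof -
  have "p ^ a * p powi e = p powi (int a + e)"
    using assms(1) by (simp add: power_int_add)
  thus ?thesis unfolding assms(2) by simp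
qed

lemma neg_one_powi_int: "(- 1 :: complex) powi (- int m) = (- 1) ^ m"
  by (simp add: power_int_minus flip: power_inverse)

lemma alt_sum_eq_pent_sum:
  assumes p: "norm p < 1" "p \<noteq> 0"
  shows "alt_sum p n = p ^ (2 * n ^ 2 + n) * pent_sum p n"
proof (induction n)
  case 0
  show ?case by (simp add: alt_sum_def pent_sum_def binomial_eq_0)
next
  case (Suc N)
  define m where "m = Suc N"
  \<comment> \<open>The growth of the normalising exponent from \<open>N\<close> to
    \<open>N + 1\<close> is the origin of \<open>p^(4N+3)\<close> in the recurrence.\<close>
  have e: "2 * m ^ 2 + m = (4 * N + 3) + (2 * N ^ 2 + N)"
    by (simp add: m_def power2_eq_square)
  have "(- 3 * int m ^ 2 + int m) = 2 * (int (m choose 2) - 2 * int m ^ 2 + int m)"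
       "(- 3 * (- int m) ^ 2 + (- int m)) = 2 * (int (m choose 2) - 2 * int m ^ 2)"
    using int_choose_two[of m] by (simp_all add: algebra_simps power2_eq_square)
  hence d: "(- 3 * int m ^ 2 + int m) div 2 = int (m choose 2) - 2 * int m ^ 2 + int m"
           "(- 3 * (- int m) ^ 2 + (- int m)) div 2 = int (m choose 2) - 2 * int m ^ 2"
    by (simp_all only: nonzero_mult_div_cancel_left[of 2] zero_neq_numeral not_False_eq_True)
  \<comment> \<open>The normalising power makes the two new exponents nonnegative, so integer powers
    give way to the natural powers of \<open>alt_sum_Suc\<close>.\<close>
  have x: "p ^ (2 * m ^ 2 + m) * p powi ((- 3 * int m ^ 2 + int m) div 2) = p ^ ((m choose 2) + m + m)"
          "p ^ (2 * m ^ 2 + m) * p powi ((- 3 * (- int m) ^ 2 + (- int m)) div 2) = p ^ ((m choose 2) + m)"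
    by (intro power_mult_powi p; unfold d; simp)+
  have "p ^ (2 * m ^ 2 + m) * pent_sum p m = p ^ (2 * m ^ 2 + m) * pent_sum p N
         + (- 1) ^ m * (p ^ (2 * m ^ 2 + m) * p powi ((- 3 * int m ^ 2 + int m) div 2)
           + p ^ (2 * m ^ 2 + m) * p powi ((- 3 * (- int m) ^ 2 + (- int m)) div 2))"
    unfolding pent_sum_def m_def sum_symmetric_Suc neg_one_powi_int power_int_of_nat
    by (simp only: algebra_simps)
  also have "\<dots> = p ^ (4 * N + 3) * alt_sum p N + (- 1) ^ m * (p ^ ((m choose 2) + m + m) + p ^ ((m choose 2) + m))"
    unfolding x Suc.IH by (simp only: e power_add mult.assoc)
  also have "\<dots> = alt_sum p m"
    unfolding m_def alt_sum_Suc[OF p(1)] by (simp add: power_add algebra_simps)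
  finally show ?case by (simp add: m_def)
qed

text \<open>Base \<open>q^2\<close> clears the halves in the exponent, and the reflection of
  \<open>j\<close> changes the sign of its linear term.\<close>

lemma pent_sum_square:
  assumes "q \<noteq> 0"
  shows "pent_sum (q ^ 2) n = (\<Sum>j = - int n..int n. (- 1) powi j * q powi (- 3 * j ^ 2 - j))"
  unfolding pent_sum_def
proof (rule sum.reindex_bij_witness[of _ uminus uminus])
  fix j :: int
  have "even (- 3 * j ^ 2 + j)" by simp
  hence "(q ^ 2) powi ((- 3 * j ^ 2 + j) div 2) = q powi (- 3 * j ^ 2 + j)"
    by (metis dvd_mult_div_cancel power_int_mult power_int_numeral)
  thus "(- 1) powi (- j) * q powi (- 3 * (- j) ^ 2 - (- j))
     = (- 1) powi j * (q ^ 2) powi ((- 3 * j ^ 2 + j) div 2)"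
    by (simp add: power_int_minus flip: power_int_inverse)
qed auto

subsection \<open>Alternative series for \<open>\<phi>\<close> and \<open>\<nu>\<close>\<close>

text \<open>Fine's function F(1/q, 0; t) in base \<open>q^2\<close>, for nonzero
  \<open>q\<close>.\<close>

definition w_sum :: "complex \<Rightarrow> complex \<Rightarrow> complex" where
  "w_sum q t = (\<Sum>n. qpoch q (q ^ 2) n * t ^ n)"

lemma norm_less_imp_norm_power_mult:
  fixes q t :: complex
  assumes "norm q < 1" "norm t < 1"
  shows "norm (t * q ^ k) < 1"
  using norm_power_mult_le[OF assms(1), of t k] assms(2) by linarith

lemma summable_w_sum:
  assumes q: "norm q < 1" and t: "norm t < 1"
  shows "summable (\<lambda>n. qpoch q (q ^ 2) n * t ^ n)"
proof -
  obtain B where B: "\<And>a n. norm a \<le> 1 \<Longrightarrow> norm (qpoch a (q ^ 2) n) \<le> B"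
    by (rule qpoch_bounded[OF norm_power2_less_1[OF q]]) blast
  have "summable (\<lambda>n. B * norm t ^ n)"
    by (intro summable_mult summable_geometric) (use t in auto)
  thus ?thesis
    by (rule summable_comparison_test'[of _ 0])
       (use B[of q] q in \<open>auto simp: norm_mult norm_power intro!: mult_right_mono\<close>)
qed

text \<open>Splitting the last factor of \<open>(q;q^2)_(n+1)\<close> as 1 minus
  \<open>q^(2n+1)\<close> gives one series at \<open>t\<close> and one at
  \<open>t q^2\<close>.\<close>

lemma w_sum_rec:
  assumes q: "norm q < 1" and t: "norm t < 1"
  shows "(1 - t) * w_sum q t = 1 - t * q * w_sum q (t * q ^ 2)"
proof -
  have tq: "norm (t * q ^ 2) < 1" by (rule norm_less_imp_norm_power_mult[OF q t])
  note S = summable_w_sum[OF q t] and S' = summable_w_sum[OF q tq]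
  have "w_sum q t - 1 = (\<Sum>n. qpoch q (q ^ 2) (Suc n) * t ^ Suc n)"
    unfolding w_sum_def using suminf_split_head[OF S] by simp
  also have "\<dots> = (\<Sum>n. t * (qpoch q (q ^ 2) n * t ^ n) - t * q * (qpoch q (q ^ 2) n * (t * q ^ 2) ^ n))"
    by (intro suminf_cong) (simp add: qpoch_Suc power_mult_distrib algebra_simps)
  also have "\<dots> = t * w_sum q t - t * q * w_sum q (t * q ^ 2)"
    unfolding w_sum_def suminf_mult[OF S, symmetric] suminf_mult[OF S', symmetric]
    by (intro suminf_diff[symmetric] summable_mult S S')
  finally show ?thesis by (simp add: algebra_simps)
qed

lemma w_sum_bounded:
  assumes q: "norm q < 1" and r: "r < 1"
  obtains B where "\<And>t. norm t \<le> r \<Longrightarrow> norm (w_sum q t) \<le> B"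
proof -
  obtain B where B: "\<And>a n. norm a \<le> 1 \<Longrightarrow> norm (qpoch a (q ^ 2) n) \<le> B"
    by (rule qpoch_bounded[OF norm_power2_less_1[OF q]]) blast
  have "norm (w_sum q t) \<le> (\<Sum>n. B * r ^ n)" if "norm t \<le> r" for t
    unfolding w_sum_def
  proof (rule norm_suminf_le)
    fix n
    have "0 \<le> r" using that norm_ge_zero order_trans by blast
    show "norm (qpoch q (q ^ 2) n * t ^ n) \<le> B * r ^ n"
      unfolding norm_mult norm_power using B[of q] q that
      by (intro mult_mono power_mono) (auto intro: order_trans[OF norm_ge_zero B[of q]])
    show "summable (\<lambda>n. B * r ^ n)"
      by (intro summable_mult summable_geometric) (use r \<open>0 \<le> r\<close> in auto)
  qed
  thus ?thesis by (rule that)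
qed

text \<open>The recurrence is iterated at \<open>t = -x, -x q^2, -x q^4, ...\<close>; each round
  splits off one summand. The values of \<open>w_sum\<close> stay bounded on the disc of radius
  \<open>norm x\<close>, so the remainder decays like \<open>norm x ^ n\<close>.\<close>

lemma w_sum_expansion:
  assumes q: "norm q < 1" and x: "norm x < 1"
  shows "(\<lambda>i. x ^ i * q ^ (i ^ 2) / qpoch (- x) (q ^ 2) (Suc i)) sums w_sum q (- x)"
proof -
  let ?P = "qpoch (- x) (q ^ 2)"
  \<comment> \<open>The remainder after \<open>n\<close> rounds.\<close>
  let ?R = "\<lambda>n. x ^ n * q ^ (n ^ 2) / ?P n * w_sum q (- (x * q ^ (2 * n)))"
  have q2: "norm (q ^ 2) < 1" by (rule norm_power2_less_1[OF q])
  have nxq: "norm (x * q ^ (2 * n)) < 1" for n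
    by (rule norm_less_imp_norm_power_mult[OF q x])
  have nz1: "1 + x * q ^ (2 * n) \<noteq> 0" for n
    using one_plus_power_neq_0[OF nxq, of 1 n] by simp
  have nz: "?P n \<noteq> 0" for n
    using nz1 by (simp add: qpoch_def mult.commute flip: power_mult)
  have fin: "w_sum q (- x) = (\<Sum>i<n. x ^ i * q ^ (i ^ 2) / ?P (Suc i)) + ?R n" for n
  proof (induction n)
    case (Suc n)
    define T where "T = x * q ^ (2 * n)"
    have T: "norm (- T) < 1" using nxq[of n] by (simp add: T_def)
    have nzT: "1 + T \<noteq> 0" unfolding T_def by (rule nz1)
    have P: "?P (Suc n) = ?P n * (1 + T)"
      by (simp add: qpoch_Suc T_def mult_ac flip: power_mult)
    have "(1 + T) * w_sum q (- T) = 1 + T * q * w_sum q (- (T * q ^ 2))"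
      using w_sum_rec[OF q T] by simp
    hence "w_sum q (- T) = (1 + T * q * w_sum q (- (T * q ^ 2))) / (1 + T)"
      using nzT by (simp add: field_simps)
    moreover have e: "x * q ^ (2 * Suc n) = T * q ^ 2"
      by (simp add: T_def power2_eq_square)
    \<comment> \<open>Round \<open>n\<close> contributes \<open>x q^(2n+1)\<close>; the odd
      exponents add up to a square.\<close>
    have "Suc n ^ 2 = n ^ 2 + 2 * n + 1"
      by (simp add: power2_eq_square)
    hence e': "x ^ Suc n * q ^ (Suc n ^ 2) = x ^ n * q ^ (n ^ 2) * (T * q)"
      by (simp only: T_def power_add power_Suc power_one_right mult_ac)
    ultimately have "?R n = x ^ n * q ^ (n ^ 2) / ?P (Suc n) + ?R (Suc n)"
      unfolding e e' unfolding P T_def[symmetric]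
      by (simp add: add_divide_distrib distrib_left mult_ac)
    thus ?case using Suc by simp
  qed (simp add: w_sum_def)
  obtain B where B: "\<And>t. norm t \<le> norm x \<Longrightarrow> norm (w_sum q t) \<le> B"
    by (rule w_sum_bounded[OF q x]) blast
  have nz_inf: "qpoch_inf (- x) (q ^ 2) \<noteq> 0"
    unfolding qpoch_inf_def using nz1
    by (intro prodinf_nonzero convergent_prod_qpoch q2) (simp add: mult.commute flip: power_mult)
  hence "(\<lambda>n. inverse (?P n)) \<longlonglongrightarrow> inverse (qpoch_inf (- x) (q ^ 2))"
    by (intro tendsto_intros qpoch_tendsto q2)
  hence "Bseq (\<lambda>n. inverse (?P n))"
    by (intro convergent_imp_Bseq convergentI)
  then obtain C where C: "C > 0" "\<And>n. norm (inverse (?P n)) \<le> C"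
    by (auto simp: Bseq_def)
  have bound: "norm (?R n) \<le> norm x ^ n * C * B" for n
  proof -
    have "norm (q ^ (n ^ 2)) \<le> 1"
      using q by (simp add: norm_power power_le_one)
    moreover have "norm (w_sum q (- (x * q ^ (2 * n)))) \<le> B"
      by (rule B) (use norm_power_mult_le[OF q, of x "2 * n"] in simp)
    ultimately have "norm x ^ n * norm (q ^ (n ^ 2)) * norm (inverse (?P n)) * norm (w_sum q (- (x * q ^ (2 * n))))
        \<le> norm x ^ n * 1 * C * B"
      by (intro mult_mono C order_refl mult_nonneg_nonneg zero_le_power norm_ge_zero)
         (use C in auto)
    thus ?thesis by (simp add: norm_mult norm_power norm_inverse divide_inverse)
  qed
  have rem: "?R \<longlonglongrightarrow> 0"
  proof (rule Lim_null_comparison[OF always_eventually])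
    show "\<forall>n. norm (?R n) \<le> norm x ^ n * C * B" using bound by blast
    have "(\<lambda>n. norm x ^ n * C * B) \<longlonglongrightarrow> 0 * C * B"
      by (intro tendsto_intros LIMSEQ_realpow_zero) (use x in auto)
    thus "(\<lambda>n. norm x ^ n * C * B) \<longlonglongrightarrow> 0" by simp
  qed
  have "(\<lambda>n. w_sum q (- x) - ?R n) \<longlonglongrightarrow> w_sum q (- x) - 0"
    by (intro tendsto_diff tendsto_const rem)
  also have "(\<lambda>n. w_sum q (- x) - ?R n) = (\<lambda>n. \<Sum>i<n. x ^ i * q ^ (i ^ 2) / ?P (Suc i))"
  proof
    fix n show "w_sum q (- x) - ?R n = (\<Sum>i<n. x ^ i * q ^ (i ^ 2) / ?P (Suc i))"
      using fin[of n] by (simp add: algebra_simps)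
  qed
  finally show ?thesis by (simp add: sums_def)
qed

lemma mock_nu_eq:
  assumes q: "norm q < 1"
  shows "mock_nu q = w_sum q (- q)"
  using sums_unique[OF w_sum_expansion[OF q q]]
  by (simp add: mock_nu_def power2_eq_square algebra_simps flip: power_add)

text \<open>The expansion at \<open>x = q^2\<close> has denominators of length \<open>i + 1\<close>;
  after multiplication by \<open>q\<close> it is the defining series without its term at index 0,
  which accounts for the 1.\<close>

lemma mock_phi_eq:
  assumes q: "norm q < 1"
  shows "mock_phi q = 1 + q * w_sum q (- (q ^ 2))"
proof -
  have "(\<lambda>i. q * ((q ^ 2) ^ i * q ^ (i ^ 2) / qpoch (- (q ^ 2)) (q ^ 2) (Suc i))) sums (q * w_sum q (- (q ^ 2)))"
    by (intro sums_mult w_sum_expansion q norm_power2_less_1)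
  moreover have "q * ((q ^ 2) ^ i * q ^ (i ^ 2)) = q ^ (Suc i ^ 2)" for i
    by (simp add: power2_eq_square algebra_simps flip: power_add power_mult)
  ultimately have "(\<lambda>i. q ^ (Suc i ^ 2) / qpoch (- (q ^ 2)) (q ^ 2) (Suc i)) sums (q * w_sum q (- (q ^ 2)))"
    by simp
  hence "(\<lambda>i. q ^ (i ^ 2) / qpoch (- (q ^ 2)) (q ^ 2) i) sums (1 + q * w_sum q (- (q ^ 2)))"
    by (subst (asm) sums_Suc_iff) (simp add: add.commute)
  thus ?thesis unfolding mock_phi_def by (rule sums_unique[symmetric])
qed

section \<open>Rearrangement of double series along diagonals\<close>

lemma diagonal_sums:
  fixes g :: "nat \<Rightarrow> nat \<Rightarrow> complex"
  assumes r: "0 \<le> r" "r < 1" and g: "\<And>j k. norm (g j k) \<le> B * r ^ (j + k)"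
  shows "(\<lambda>n. \<Sum>k\<le>n. g (n - k) k) sums (\<Sum>j. \<Sum>k. g j k)"
proof -
  have geo: "(\<lambda>k. r ^ k) sums (1 / (1 - r))"
    using r by (intro geometric_sums) auto
  have "B \<ge> 0" using order_trans[OF norm_ge_zero g[of 0 0]] by simp
  have geo': "((\<lambda>k. B * r ^ (j + k)) has_sum (B * r ^ j * (1 / (1 - r)))) UNIV" for j
    using sums_mult[OF geo, of "B * r ^ j"] \<open>B \<ge> 0\<close> r
    by (intro sums_nonneg_imp_has_sum) (simp_all add: power_add mult_ac)
  have "(\<lambda>j. B * (1 / (1 - r)) * r ^ j) sums (B * (1 / (1 - r)) * (1 / (1 - r)))"
    by (intro sums_mult geo)
  hence "(\<lambda>j. B * r ^ j * (1 / (1 - r))) summable_on UNIV"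
    using \<open>B \<ge> 0\<close> r by (intro has_sum_imp_summable[OF sums_nonneg_imp_has_sum]) (simp_all add: mult_ac)
  hence "(\<lambda>(j, k). B * r ^ (j + k)) summable_on UNIV \<times> UNIV"
    using \<open>B \<ge> 0\<close> r geo' by (intro summable_on_SigmaI[where g = "\<lambda>j. B * r ^ j * (1 / (1 - r))"]) auto
  hence "(\<lambda>x. norm (case x of (j, k) \<Rightarrow> g j k)) summable_on UNIV \<times> UNIV"
    by (rule summable_on_comparison_test) (use g in auto)
  hence sg: "(\<lambda>(j, k). g j k) summable_on UNIV \<times> UNIV"
    by (rule abs_summable_summable)
  define S where "S = infsum (\<lambda>(j, k). g j k) (UNIV \<times> UNIV)"
  have hs: "((\<lambda>(j, k). g j k) has_sum S) (UNIV \<times> UNIV)"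
    unfolding S_def using sg by (rule has_sum_infsum)
  have sj: "summable (g j)" for j
  proof (rule summable_comparison_test'[of "\<lambda>k. B * r ^ j * r ^ k" 0])
    show "summable (\<lambda>k. B * r ^ j * r ^ k)"
      using r by (intro summable_mult summable_geometric) auto
  qed (use g[of j] in \<open>simp add: power_add mult_ac\<close>)
  have nsj: "summable (\<lambda>k. norm (g j k))" for j
  proof (rule summable_comparison_test'[of "\<lambda>k. B * r ^ j * r ^ k" 0])
    show "summable (\<lambda>k. B * r ^ j * r ^ k)"
      using r by (intro summable_mult summable_geometric) auto
  qed (use g[of j] in \<open>simp add: power_add mult_ac\<close>)
  have "((\<lambda>j. \<Sum>k. g j k) has_sum S) UNIV"
  proof (rule has_sum_SigmaD[OF hs])
    fix j show "((\<lambda>k. case (j, k) of (j, k) \<Rightarrow> g j k) has_sum (\<Sum>k. g j k)) UNIV"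
      using norm_summable_imp_has_sum[OF nsj summable_sums[OF sj]] by simp
  qed
  hence S1: "(\<lambda>j. \<Sum>k. g j k) sums S" by (rule has_sum_imp_sums)
  \<comment> \<open>The total \<open>S\<close>, already evaluated by rows, is now taken along the
    diagonals \<open>n = j + k\<close>.\<close>
  have "((\<lambda>(n, k). g (n - k) k) has_sum S) (SIGMA n:UNIV. {..n})"
    using hs
    by (subst has_sum_reindex_bij_witness[of "UNIV \<times> UNIV" "\<lambda>(n, k). (n - k, k)" "\<lambda>(j, k). (j + k, k)", symmetric]) auto
  hence "((\<lambda>n. \<Sum>k\<le>n. g (n - k) k) has_sum S) UNIV"
    by (rule has_sum_SigmaD) (auto intro!: has_sum_finiteI)
  hence "(\<lambda>n. \<Sum>k\<le>n. g (n - k) k) sums S" by (rule has_sum_imp_sums)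
  thus "(\<lambda>n. \<Sum>k\<le>n. g (n - k) k) sums (\<Sum>j. \<Sum>k. g j k)"
    using sums_unique[OF S1] by simp
qed

subsection \<open>Sums over cones\<close>

text \<open>Row \<open>n\<close> has \<open>2 n + 1\<close> entries, each at most
  \<open>r^n\<close>, and the series of \<open>(2 n + 1) r^n\<close> converges, being dominated by
  twice a differentiated geometric series.\<close>

lemma cone_half_sums:
  fixes F :: "nat \<Rightarrow> int \<Rightarrow> complex"
  assumes r: "0 \<le> r" "r < 1"
    and F: "\<And>n j. \<bar>j\<bar> \<le> int n \<Longrightarrow> norm (F n j) \<le> r ^ n"
  shows "(\<lambda>(n, j). F n j) summable_on (SIGMA n:UNIV. {- int n..int n})"
    and "(\<lambda>n. \<Sum>j = - int n..int n. F n j) sums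
           infsum (\<lambda>(n, j). F n j) (SIGMA n:UNIV. {- int n..int n})"
proof -
  have "summable (\<lambda>n. 2 * (of_nat (Suc n) * r ^ n))"
    using r by (intro summable_mult sums_summable[OF geometric_deriv_sums]) auto
  hence "summable (\<lambda>n. real (2 * n + 1) * r ^ n)"
    by (rule summable_comparison_test'[of _ 0]) (use r in \<open>auto intro!: mult_right_mono simp: mult.assoc[symmetric]\<close>)
  hence "(\<lambda>n. real (2 * n + 1) * r ^ n) summable_on UNIV"
    using r by (intro norm_summable_imp_summable_on) simp
  moreover have "((\<lambda>j. r ^ n) has_sum (real (2 * n + 1) * r ^ n)) {- int n..int n}" for n
    by (rule has_sum_finiteI) (auto simp: nat_add_distrib)
  ultimately have "(\<lambda>(n, j). r ^ n) summable_on (SIGMA n:UNIV. {- int n..int n})"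
    using r by (intro summable_on_SigmaI[where g = "\<lambda>n. real (2 * n + 1) * r ^ n"]) auto
  hence "(\<lambda>x. norm (case x of (n, j) \<Rightarrow> F n j)) summable_on (SIGMA n:UNIV. {- int n..int n})"
    by (rule summable_on_comparison_test) (auto intro!: F)
  thus s: "(\<lambda>(n, j). F n j) summable_on (SIGMA n:UNIV. {- int n..int n})"
    by (rule abs_summable_summable)
  have "((\<lambda>n. \<Sum>j = - int n..int n. F n j) has_sum
           infsum (\<lambda>(n, j). F n j) (SIGMA n:UNIV. {- int n..int n})) UNIV"
    by (rule has_sum_SigmaD[OF has_sum_infsum[OF s]]) (auto intro!: has_sum_finiteI)
  thus "(\<lambda>n. \<Sum>j = - int n..int n. F n j) sums
           infsum (\<lambda>(n, j). F n j) (SIGMA n:UNIV. {- int n..int n})"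
    by (rule has_sum_imp_sums)
qed

text \<open>The substitution of \<open>- n - 1\<close> for \<open>n\<close> carries the negative
  half cone to the same region \<open>|j| \<le> n\<close> as the positive one, so the two halves can
  be subtracted row by row. The halves are also stated to be summable separately.\<close>

lemma cone_sums:
  fixes F :: "int \<Rightarrow> int \<Rightarrow> complex"
  assumes r: "0 \<le> r" "r < 1"
    and F: "\<And>n j. \<bar>j\<bar> \<le> int n \<Longrightarrow> norm (F (int n) j) \<le> r ^ n"
    and F': "\<And>n j. \<bar>j\<bar> \<le> int n \<Longrightarrow> norm (F (- int n - 1) j) \<le> r ^ n"
  shows "(\<lambda>(n, j). F n j) summable_on {(n, j). n + j \<ge> 0 \<and> n - j \<ge> 0}"
    and "(\<lambda>(n, j). F n j) summable_on {(n, j). n + j < 0 \<and> n - j < 0}"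
    and "summable (\<lambda>n. \<Sum>j = - int n..int n. F (int n) j)"
    and "summable (\<lambda>n. \<Sum>j = - int n..int n. F (- int n - 1) j)"
    and "(\<lambda>n. (\<Sum>j = - int n..int n. F (int n) j) - (\<Sum>j = - int n..int n. F (- int n - 1) j)) sums cone_sum F"
proof -
  let ?S = "SIGMA n:UNIV. {- int n..int n}"
  note P = cone_half_sums[of r "\<lambda>n. F (int n)", OF r F]
  note N = cone_half_sums[of r "\<lambda>n. F (- int n - 1)", OF r F']
  have "(\<lambda>(n, j). F (int n) j) summable_on ?S \<longleftrightarrow>
        (\<lambda>(n, j). F n j) summable_on {(n, j). n + j \<ge> 0 \<and> n - j \<ge> 0}"
    by (rule summable_on_reindex_bij_witness[of _ "\<lambda>(n, j). (nat n, j)" "\<lambda>(n, j). (int n, j)"]) auto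
  thus "(\<lambda>(n, j). F n j) summable_on {(n, j). n + j \<ge> 0 \<and> n - j \<ge> 0}"
    using P(1) by blast
  have "(\<lambda>(n, j). F (- int n - 1) j) summable_on ?S \<longleftrightarrow>
        (\<lambda>(n, j). F n j) summable_on {(n, j). n + j < 0 \<and> n - j < 0}"
    by (rule summable_on_reindex_bij_witness[of _ "\<lambda>(n, j). (nat (- n - 1), j)" "\<lambda>(n, j). (- int n - 1, j)"]) auto
  thus "(\<lambda>(n, j). F n j) summable_on {(n, j). n + j < 0 \<and> n - j < 0}"
    using N(1) by blast
  have "infsum (\<lambda>(n, j). F (int n) j) ?S =
        infsum (\<lambda>(n, j). F n j) {(n, j). n + j \<ge> 0 \<and> n - j \<ge> 0}"
    by (rule infsum_reindex_bij_witness[of _ "\<lambda>(n, j). (nat n, j)" "\<lambda>(n, j). (int n, j)"]) auto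
  moreover have "infsum (\<lambda>(n, j). F (- int n - 1) j) ?S =
        infsum (\<lambda>(n, j). F n j) {(n, j). n + j < 0 \<and> n - j < 0}"
    by (rule infsum_reindex_bij_witness[of _ "\<lambda>(n, j). (nat (- n - 1), j)" "\<lambda>(n, j). (- int n - 1, j)"]) auto
  ultimately show "(\<lambda>n. (\<Sum>j = - int n..int n. F (int n) j) - (\<Sum>j = - int n..int n. F (- int n - 1) j)) sums cone_sum F"
    using sums_diff[OF P(2) N(2)] by (simp add: cone_sum_def)
  show "summable (\<lambda>n. \<Sum>j = - int n..int n. F (int n) j)"
    using P(2) by (rule sums_summable)
  show "summable (\<lambda>n. \<Sum>j = - int n..int n. F (- int n - 1) j)"
    using N(2) by (rule sums_summable)
qed

section \<open>Geometric majorants and rows of the four cone sums\<close>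

lemma norm_powi_le:
  fixes q :: complex
  assumes "norm q < 1" "q \<noteq> 0" "e \<ge> int n"
  shows "norm (q powi e) \<le> norm q ^ n"
  using power_int_decreasing[of "int n" e "norm q"] assms by (simp add: norm_power_int)

lemma norm_neg_one_powi [simp]: "norm ((- 1 :: complex) powi j) = 1"
  by (simp add: norm_power_int)

lemma pent_exponent: "2 * ((- 3 * j ^ 2 + j) div 2) = - 3 * j ^ 2 + (j :: int)"
  by (intro dvd_mult_div_cancel) simp

context
  fixes j :: int and n :: nat
  assumes j: "\<bar>j\<bar> \<le> int n"
begin

private lemma j_bounds: "j ^ 2 \<le> int n ^ 2" "int n \<le> int n ^ 2" "0 \<le> int n"
proof -
  show "j ^ 2 \<le> int n ^ 2" using abs_le_square_iff[of j "int n"] j by simp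
  show "int n \<le> int n ^ 2" by (cases n) (simp_all add: power2_eq_square)
qed simp

private lemma square_minus: "(- int n - 1) ^ 2 = int n ^ 2 + 2 * int n + 1"
  by (simp add: power2_eq_square algebra_simps)

text \<open>The quadratic forms are indefinite, but on the cone \<open>j^2 \<le> n^2\<close> leaves
  a positive multiple of \<open>n^2\<close>, and \<open>n \<le> n^2\<close> turns this into the
  linear bound behind the geometric majorant. The bounds for the other three forms arise in the same
  way.\<close>

lemma exponent_phi_bounds:
  "int n \<le> 2 * int n ^ 2 + int n + (- 3 * j ^ 2 + j) div 2"
  "int n \<le> 2 * (- int n - 1) ^ 2 + (- int n - 1) + (- 3 * j ^ 2 + j) div 2"
  unfolding square_minus using pent_exponent[of j] j_bounds j by - (smt (verit))+

lemma exponent_nu_bounds: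
  "int n \<le> 2 * int n ^ 2 + 2 * int n + (- 3 * j ^ 2 + j) div 2"
  "int n \<le> 2 * (- int n - 1) ^ 2 + 2 * (- int n - 1) + (- 3 * j ^ 2 + j) div 2"
  unfolding square_minus using pent_exponent[of j] j_bounds j by - (smt (verit))+

lemma exponent_phi_bar_0_bounds:
  "int n \<le> 4 * int n ^ 2 + int n - 3 * j ^ 2 - j"
  "int n \<le> 4 * (- int n - 1) ^ 2 + (- int n - 1) - 3 * j ^ 2 - j"
  unfolding square_minus using j_bounds j by - (smt (verit))+

lemma exponent_phi_bar_1_bounds:
  "int n \<le> 4 * int n ^ 2 + 3 * int n - 3 * j ^ 2 - j"
  "int n \<le> 4 * (- int n - 1) ^ 2 + 3 * (- int n - 1) - 3 * j ^ 2 - j"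
  unfolding square_minus using j_bounds j by - (smt (verit))+

end

lemma powi_split:
  fixes q :: complex
  assumes "q \<noteq> 0" "e = int m + e'"
  shows "q powi e = q ^ m * q powi e'"
  using assms by (simp add: power_int_add)

lemma neg_one_powi_minus_Suc: "(- 1 :: complex) powi (- int n - 1 + j) = - ((- 1) ^ n * (- 1) powi j)"
  "(- 1 :: complex) powi (int n + j) = (- 1) ^ n * (- 1) powi j"
proof -
  have "- int n - 1 + j = - int (Suc n) + j" by simp
  hence "(- 1 :: complex) powi (- int n - 1 + j) = (- 1) powi (- int (Suc n)) * (- 1) powi j"
    by (simp only:) (subst power_int_add, auto)
  thus "(- 1 :: complex) powi (- int n - 1 + j) = - ((- 1) ^ n * (- 1) powi j)"
    unfolding neg_one_powi_int by simp
  show "(- 1 :: complex) powi (int n + j) = (- 1) ^ n * (- 1) powi j"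
    by (simp add: power_int_add)
qed

definition F_phi :: "complex \<Rightarrow> int \<Rightarrow> int \<Rightarrow> complex" where
  "F_phi q n j = (- 1) powi (n + j) * q powi (2 * n ^ 2 + n + (- 3 * j ^ 2 + j) div 2)"

definition F_nu :: "complex \<Rightarrow> int \<Rightarrow> int \<Rightarrow> complex" where
  "F_nu q n j = (- 1) powi (n + j) * q powi (2 * n ^ 2 + 2 * n + (- 3 * j ^ 2 + j) div 2)"

definition F_phi_bar_0 :: "complex \<Rightarrow> int \<Rightarrow> int \<Rightarrow> complex" where
  "F_phi_bar_0 q n j = (- 1) powi j * q powi (4 * n ^ 2 + n - 3 * j ^ 2 - j)"

definition F_phi_bar_1 :: "complex \<Rightarrow> int \<Rightarrow> int \<Rightarrow> complex" where
  "F_phi_bar_1 q n j = (- 1) powi j * q powi (4 * n ^ 2 + 3 * n - 3 * j ^ 2 - j)"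

context
  fixes q :: complex
  assumes q: "norm q < 1" "q \<noteq> 0"
begin

lemma norm_cone_term_le:
  assumes "int n \<le> e"
  shows "norm ((- 1) powi s * q powi e) \<le> norm q ^ n"
  using norm_powi_le[OF q assms] by (simp add: norm_mult)

lemmas F_phi_cone_sums = cone_sums[of "norm q" "F_phi q", OF norm_ge_zero q(1),
    unfolded F_phi_def, OF norm_cone_term_le norm_cone_term_le,
    OF exponent_phi_bounds, folded F_phi_def]

lemmas F_nu_cone_sums = cone_sums[of "norm q" "F_nu q", OF norm_ge_zero q(1),
    unfolded F_nu_def, OF norm_cone_term_le norm_cone_term_le,
    OF exponent_nu_bounds, folded F_nu_def]

lemmas F_phi_bar_0_cone_sums = cone_sums[of "norm q" "F_phi_bar_0 q", OF norm_ge_zero q(1),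
    unfolded F_phi_bar_0_def, OF norm_cone_term_le norm_cone_term_le,
    OF exponent_phi_bar_0_bounds, folded F_phi_bar_0_def]

lemmas F_phi_bar_1_cone_sums = cone_sums[of "norm q" "F_phi_bar_1 q", OF norm_ge_zero q(1),
    unfolded F_phi_bar_1_def, OF norm_cone_term_le norm_cone_term_le,
    OF exponent_phi_bar_1_bounds, folded F_phi_bar_1_def]

text \<open>Reflecting \<open>n\<close> to \<open>- n - 1\<close> raises the exponent by
  \<open>2n + 1\<close> and flips the sign of \<open>(-1)^n\<close>; the difference of the half
  cones therefore carries \<open>1 + q^(2n+1)\<close>.\<close>

lemma F_phi_row:
  "(\<Sum>j = - int n..int n. F_phi q (int n) j) = (- 1) ^ n * q ^ (2 * n ^ 2 + n) * pent_sum q n"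
  "(\<Sum>j = - int n..int n. F_phi q (- int n - 1) j)
     = - ((- 1) ^ n * q ^ (2 * n ^ 2 + n) * q ^ (2 * n + 1) * pent_sum q n)"
proof -
  have "F_phi q (int n) j = (- 1) ^ n * q ^ (2 * n ^ 2 + n) * ((- 1) powi j * q powi ((- 3 * j ^ 2 + j) div 2))" for j
    unfolding F_phi_def neg_one_powi_minus_Suc
    by (subst powi_split[OF q(2), of _ "2 * n ^ 2 + n" "(- 3 * j ^ 2 + j) div 2"]) simp_all
  thus "(\<Sum>j = - int n..int n. F_phi q (int n) j) = (- 1) ^ n * q ^ (2 * n ^ 2 + n) * pent_sum q n"
    by (simp add: pent_sum_def sum_distrib_left)
  have "F_phi q (- int n - 1) j =
    - ((- 1) ^ n * q ^ (2 * n ^ 2 + n) * q ^ (2 * n + 1)) * ((- 1) powi j * q powi ((- 3 * j ^ 2 + j) div 2))" for j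
  proof -
    have "q powi (2 * (- int n - 1) ^ 2 + (- int n - 1) + (- 3 * j ^ 2 + j) div 2)
        = q ^ (2 * n ^ 2 + n) * q ^ (2 * n + 1) * q powi ((- 3 * j ^ 2 + j) div 2)"
      unfolding power_add[symmetric]
      by (rule powi_split[OF q(2)]) (simp add: power2_eq_square algebra_simps)
    thus ?thesis unfolding F_phi_def neg_one_powi_minus_Suc by simp
  qed
  thus "(\<Sum>j = - int n..int n. F_phi q (- int n - 1) j)
     = - ((- 1) ^ n * q ^ (2 * n ^ 2 + n) * q ^ (2 * n + 1) * pent_sum q n)"
    by (simp only: pent_sum_def sum_distrib_left) (simp add: sum_negf)
qed

text \<open>\<open>2 n^2 + 2 n\<close> is invariant under the reflection and only the sign flips, so
  both half cones contribute equally; hence the factor 1/2 in the identity for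
  \<open>mock_nu\<close>.\<close>

lemma F_nu_row:
  "(\<Sum>j = - int n..int n. F_nu q (int n) j) = (- 1) ^ n * q ^ (2 * n ^ 2 + 2 * n) * pent_sum q n"
  "(\<Sum>j = - int n..int n. F_nu q (- int n - 1) j)
     = - ((- 1) ^ n * q ^ (2 * n ^ 2 + 2 * n) * pent_sum q n)"
proof -
  have "F_nu q (int n) j = (- 1) ^ n * q ^ (2 * n ^ 2 + 2 * n) * ((- 1) powi j * q powi ((- 3 * j ^ 2 + j) div 2))" for j
    unfolding F_nu_def neg_one_powi_minus_Suc
    by (subst powi_split[OF q(2), of _ "2 * n ^ 2 + 2 * n" "(- 3 * j ^ 2 + j) div 2"]) simp_all
  thus "(\<Sum>j = - int n..int n. F_nu q (int n) j) = (- 1) ^ n * q ^ (2 * n ^ 2 + 2 * n) * pent_sum q n"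
    by (simp add: pent_sum_def sum_distrib_left)
  have "F_nu q (- int n - 1) j =
    - ((- 1) ^ n * q ^ (2 * n ^ 2 + 2 * n)) * ((- 1) powi j * q powi ((- 3 * j ^ 2 + j) div 2))" for j
    unfolding F_nu_def neg_one_powi_minus_Suc
    by (subst powi_split[OF q(2), of _ "2 * n ^ 2 + 2 * n" "(- 3 * j ^ 2 + j) div 2"])
       (simp_all add: power2_eq_square algebra_simps)
  thus "(\<Sum>j = - int n..int n. F_nu q (- int n - 1) j)
     = - ((- 1) ^ n * q ^ (2 * n ^ 2 + 2 * n) * pent_sum q n)"
    by (simp only: pent_sum_def sum_distrib_left) (simp add: sum_negf)
qed

text \<open>The sign depends on \<open>j\<close> alone and survives the reflection, while the
  exponent grows by \<open>6n + 3\<close>; so the difference carries \<open>1 - q^(6n+3)\<close>.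
  For \<open>F_phi_bar_1\<close> the growth is \<open>2n + 1\<close>.\<close>

lemma F_phi_bar_0_row:
  "(\<Sum>j = - int n..int n. F_phi_bar_0 q (int n) j) = q ^ (4 * n ^ 2 + n) * pent_sum (q ^ 2) n"
  "(\<Sum>j = - int n..int n. F_phi_bar_0 q (- int n - 1) j)
     = q ^ (4 * n ^ 2 + n) * q ^ (6 * n + 3) * pent_sum (q ^ 2) n"
proof -
  have "F_phi_bar_0 q (int n) j = q ^ (4 * n ^ 2 + n) * ((- 1) powi j * q powi (- 3 * j ^ 2 - j))" for j
    unfolding F_phi_bar_0_def
    by (subst powi_split[OF q(2), of _ "4 * n ^ 2 + n" "- 3 * j ^ 2 - j"]) simp_all
  thus "(\<Sum>j = - int n..int n. F_phi_bar_0 q (int n) j) = q ^ (4 * n ^ 2 + n) * pent_sum (q ^ 2) n"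
    by (simp add: pent_sum_square[OF q(2)] sum_distrib_left)
  have "F_phi_bar_0 q (- int n - 1) j =
    q ^ (4 * n ^ 2 + n) * q ^ (6 * n + 3) * ((- 1) powi j * q powi (- 3 * j ^ 2 - j))" for j
  proof -
    have "q powi (4 * (- int n - 1) ^ 2 + (- int n - 1) - 3 * j ^ 2 - j)
        = q ^ (4 * n ^ 2 + n) * q ^ (6 * n + 3) * q powi (- 3 * j ^ 2 - j)"
      unfolding power_add[symmetric]
      by (rule powi_split[OF q(2)]) (simp add: power2_eq_square algebra_simps)
    thus ?thesis unfolding F_phi_bar_0_def by simp
  qed
  thus "(\<Sum>j = - int n..int n. F_phi_bar_0 q (- int n - 1) j)
     = q ^ (4 * n ^ 2 + n) * q ^ (6 * n + 3) * pent_sum (q ^ 2) n"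
    by (simp only: pent_sum_square[OF q(2)] sum_distrib_left)
qed

lemma F_phi_bar_1_row:
  "(\<Sum>j = - int n..int n. F_phi_bar_1 q (int n) j) = q ^ (4 * n ^ 2 + 3 * n) * pent_sum (q ^ 2) n"
  "(\<Sum>j = - int n..int n. F_phi_bar_1 q (- int n - 1) j)
     = q ^ (4 * n ^ 2 + 3 * n) * q ^ (2 * n + 1) * pent_sum (q ^ 2) n"
proof -
  have "F_phi_bar_1 q (int n) j = q ^ (4 * n ^ 2 + 3 * n) * ((- 1) powi j * q powi (- 3 * j ^ 2 - j))" for j
    unfolding F_phi_bar_1_def
    by (subst powi_split[OF q(2), of _ "4 * n ^ 2 + 3 * n" "- 3 * j ^ 2 - j"]) simp_all
  thus "(\<Sum>j = - int n..int n. F_phi_bar_1 q (int n) j) = q ^ (4 * n ^ 2 + 3 * n) * pent_sum (q ^ 2) n"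
    by (simp add: pent_sum_square[OF q(2)] sum_distrib_left)
  have "F_phi_bar_1 q (- int n - 1) j =
    q ^ (4 * n ^ 2 + 3 * n) * q ^ (2 * n + 1) * ((- 1) powi j * q powi (- 3 * j ^ 2 - j))" for j
  proof -
    have "q powi (4 * (- int n - 1) ^ 2 + 3 * (- int n - 1) - 3 * j ^ 2 - j)
        = q ^ (4 * n ^ 2 + 3 * n) * q ^ (2 * n + 1) * q powi (- 3 * j ^ 2 - j)"
      unfolding power_add[symmetric]
      by (rule powi_split[OF q(2)]) (simp add: power2_eq_square algebra_simps)
    thus ?thesis unfolding F_phi_bar_1_def by simp
  qed
  thus "(\<Sum>j = - int n..int n. F_phi_bar_1 q (- int n - 1) j)
     = q ^ (4 * n ^ 2 + 3 * n) * q ^ (2 * n + 1) * pent_sum (q ^ 2) n"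
    by (simp only: pent_sum_square[OF q(2)] sum_distrib_left)
qed

end

subsection \<open>Exchanging the order of summation\<close>

lemma term_bounded:
  fixes p :: complex
  assumes p: "norm p < 1"
  obtains B where "B > 0"
    "\<And>m k. norm (p ^ (k choose 2) * (qpoch p p m / qpoch p p k)) \<le> B"
proof -
  obtain B where B: "B > 0" "\<And>m k. norm (qpoch p p m / qpoch p p k) \<le> B"
    using qpoch_ratio_bounded[OF p] p by (metis less_imp_le)
  have "norm (p ^ (k choose 2) * (qpoch p p m / qpoch p p k)) \<le> B" for m k
  proof -
    have "norm (p ^ (k choose 2)) * norm (qpoch p p m / qpoch p p k) \<le> 1 * B"
      by (intro mult_mono B) (use p in \<open>auto simp: norm_power power_le_one\<close>)
    thus ?thesis by (simp add: norm_mult norm_divide)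
  qed
  thus ?thesis using B(1) that by blast
qed

text \<open>The partial sums of \<open>t n + t (Suc n)\<close> are twice those of \<open>t\<close>
  up to the two end terms. The null limit cannot be dropped: for \<open>t n = (-1)^n\<close> all the
  paired terms vanish.\<close>

lemma sums_add_consecutive:
  fixes t :: "nat \<Rightarrow> complex"
  assumes "(\<lambda>n. t n + t (Suc n)) sums s" "t \<longlonglongrightarrow> 0"
  shows "t sums ((s + t 0) / 2)"
proof -
  have "(\<Sum>i<n. t i + t (Suc i)) = 2 * (\<Sum>i<n. t i) + t n - t 0" for n
    by (induction n) (simp_all add: algebra_simps)
  hence eq: "(\<Sum>i<n. t i) = ((\<Sum>i<n. t i + t (Suc i)) - t n + t 0) / 2" for n
    by simp
  have "(\<lambda>n. ((\<Sum>i<n. t i + t (Suc i)) - t n + t 0) / 2) \<longlonglongrightarrow> (s - 0 + t 0) / 2"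
    using assms by (intro tendsto_intros) (auto simp: sums_def)
  thus ?thesis unfolding sums_def eq by simp
qed

section \<open>Theta factors, and the double series for \<open>mock_nu\<close> and
  \<open>mock_phi\<close>\<close>

context
  fixes q :: complex
  assumes q: "norm q < 1" "q \<noteq> 0"
begin

private lemma q2: "norm (q ^ 2) < 1"
  by (rule norm_power2_less_1[OF q(1)])

text \<open>The residue classes 1 and 3 modulo 4 merge into \<open>(-q;q^2)_\<infinity>\<close>, and
  \<open>(q^4;q^4)_\<infinity>\<close> splits as
  \<open>(q^2;q^2)_\<infinity> (-q^2;q^2)_\<infinity>\<close>.\<close>

lemma theta_J_bar_1_4: "theta_J_bar 1 4 q = qpoch_inf (- q) q * qpoch_inf (q ^ 2) (q ^ 2)"
proof -
  have q4: "q ^ 4 = (q ^ 2) ^ 2" by (simp flip: power_mult)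
  have e: "(q ^ 2) ^ 2 / (- q) = q ^ 2 * - q" using q(2) by (simp add: power2_eq_square)
  have "theta_J_bar 1 4 q = qpoch_inf (- q) (q ^ 4) * qpoch_inf (q ^ 4 / (- q)) (q ^ 4) * qpoch_inf (q ^ 4) (q ^ 4)"
    by (simp add: theta_J_bar_def theta_j_def)
  also have "\<dots> = qpoch_inf (- q) ((q ^ 2) ^ 2) * qpoch_inf (q ^ 2 * - q) ((q ^ 2) ^ 2)
          * qpoch_inf ((q ^ 2) ^ 2) ((q ^ 2) ^ 2)"
    unfolding q4 e ..
  also have "\<dots> = qpoch_inf (- q) (q ^ 2) * (qpoch_inf (q ^ 2) (q ^ 2) * qpoch_inf (- (q ^ 2)) (q ^ 2))"
    by (simp only: qpoch_inf_split_parity[OF q2, of "- q"] qpoch_inf_mult_minus[OF q2, of "q ^ 2"])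
  also have "\<dots> = qpoch_inf (- q) q * qpoch_inf (q ^ 2) (q ^ 2)"
    using qpoch_inf_split_parity[OF q(1), of "- q"] by (simp add: power2_eq_square mult_ac)
  finally show ?thesis .
qed

lemma theta_J_1_2: "theta_J 1 2 q = qpoch_inf q q * qpoch_inf q (q ^ 2)"
proof -
  have "theta_J 1 2 q = qpoch_inf q (q ^ 2) * qpoch_inf q (q ^ 2) * qpoch_inf (q * q) (q ^ 2)"
    using q(2) by (simp add: theta_J_def theta_j_def power2_eq_square)
  thus ?thesis by (simp add: qpoch_inf_split_parity[OF q(1), of q] mult_ac)
qed

text \<open>This makes the theta factor independent of the row: the even half of
  \<open>(q;q)_(2j)\<close> completes the tail \<open>(q^(2j+2);q^2)_\<infinity>\<close> to the full
  product, and the odd half is what remains.\<close>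

lemma qpoch_mult_Lebesgue:
  "qpoch q q (2 * j) * (qpoch_inf (q ^ (2 * j + 1) * q) (q ^ 2) * qpoch_inf (- q) q)
     = theta_J_bar 1 4 q * qpoch q (q ^ 2) j"
proof -
  have "q ^ (2 * j + 1) * q = (q ^ 2) ^ j * q ^ 2"
    unfolding power_mult[symmetric] by (simp add: power2_eq_square)
  hence "qpoch_inf (q ^ 2) (q ^ 2) = qpoch (q ^ 2) (q ^ 2) j * qpoch_inf (q ^ (2 * j + 1) * q) (q ^ 2)"
    using qpoch_inf_split[OF q2, of "q ^ 2" j] by (simp only:)
  moreover have "qpoch q q (2 * j) = qpoch q (q ^ 2) j * qpoch (q ^ 2) (q ^ 2) j"
    unfolding qpoch_split_parity by (simp add: power2_eq_square)
  ultimately show ?thesis by (simp add: theta_J_bar_1_4 mult_ac)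
qed

lemma nu_alt_sums: "(\<lambda>n. (- 1) ^ n * q ^ n * alt_sum q n) sums (theta_J_bar 1 4 q * w_sum q (- q))"
proof -
  \<comment> \<open>The summand at \<open>n = j + k\<close>: here \<open>2n - k = 2j + k\<close>,
    and \<open>(-1)^n (-1)^k = (-1)^j\<close>, so the sum over \<open>k\<close> carries no
    sign.\<close>
  define g where "g j k = (- 1) ^ j * q ^ (j + k) * (q ^ (k choose 2) * (qpoch q q (2 * j + k) / qpoch q q k))" for j k
  obtain B where B: "\<And>m k. norm (q ^ (k choose 2) * (qpoch q q m / qpoch q q k)) \<le> B"
    by (rule term_bounded[OF q(1)]) blast
  have gB: "norm (g j k) \<le> B * norm q ^ (j + k)" for j k
    using mult_left_mono[OF B[of k "2 * j + k"], of "norm q ^ (j + k)"]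
    unfolding g_def norm_mult norm_power by (simp add: mult_ac)
  have "(\<Sum>k\<le>n. g (n - k) k) = (- 1) ^ n * q ^ n * alt_sum q n" for n
    unfolding alt_sum_def sum_distrib_left
  proof (rule sum.cong[OF refl])
    fix k assume "k \<in> {..n}"
    hence "2 * (n - k) + k = 2 * n - k" "n - k + k = n" by auto
    moreover have "(- 1 :: complex) ^ (n - k) = (- 1) ^ n * (- 1) ^ k"
      using \<open>k \<in> {..n}\<close> by (auto simp: minus_one_power_iff)
    ultimately show "g (n - k) k = (- 1) ^ n * q ^ n * ((- 1) ^ k * q ^ (k choose 2) * (qpoch q q (2 * n - k) / qpoch q q k))"
      unfolding g_def by (simp only: mult_ac)
  qed
  moreover have "(\<Sum>k. g j k) = theta_J_bar 1 4 q * (qpoch q (q ^ 2) j * (- q) ^ j)" for j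
  proof -
    have a: "norm (q ^ (2 * j + 1)) < 1"
      using q(1) by (simp add: norm_power norm_mult power_less_one_iff del: power_Suc power_add)
    have "(\<Sum>k. g j k) = (\<Sum>k. (- q) ^ j * qpoch q q (2 * j) *
        (q ^ (k choose 2) * q ^ k * (qpoch (q ^ (2 * j + 1)) q k / qpoch q q k)))"
      by (intro suminf_cong) (simp add: g_def qpoch_add power_add power_minus[of q] mult_ac)
    also have "\<dots> = (- q) ^ j * qpoch q q (2 * j) * Phi (q ^ (2 * j + 1)) q q"
      unfolding Phi_def by (intro suminf_mult summable_Phi q less_imp_le a)
    also have "Phi (q ^ (2 * j + 1)) q q = qpoch_inf (q ^ (2 * j + 1) * q) (q ^ 2) * qpoch_inf (- q) q"
      by (rule Lebesgue_identity[OF q(1) a])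
    also have "(- q) ^ j * qpoch q q (2 * j) * (qpoch_inf (q ^ (2 * j + 1) * q) (q ^ 2) * qpoch_inf (- q) q)
       = theta_J_bar 1 4 q * (qpoch q (q ^ 2) j * (- q) ^ j)"
      by (simp only: mult.assoc qpoch_mult_Lebesgue) (simp only: mult_ac)
    finally show ?thesis .
  qed
  ultimately have "(\<lambda>n. (- 1) ^ n * q ^ n * alt_sum q n) sums
       (\<Sum>j. theta_J_bar 1 4 q * (qpoch q (q ^ 2) j * (- q) ^ j))"
    using diagonal_sums[OF norm_ge_zero q(1) gB] by simp
  also have "(\<Sum>j. theta_J_bar 1 4 q * (qpoch q (q ^ 2) j * (- q) ^ j)) = theta_J_bar 1 4 q * w_sum q (- q)"
    unfolding w_sum_def by (intro suminf_mult summable_w_sum) (use q in auto)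
  finally show ?thesis .
qed

text \<open>The double series behind this identity is not absolutely convergent. Grouping the \<open>n\<close>-th
  diagonal with the next one turns \<open>h j k\<close> into \<open>h j k - h (j + 1) k\<close>, which is.\<close>

lemma phi_alt_sums:
  assumes lim: "(\<lambda>n. (- 1) ^ n * (1 + q ^ (2 * n + 1)) * alt_sum q n) \<longlonglongrightarrow> 0"
  shows "(\<lambda>n. (- 1) ^ n * (1 + q ^ (2 * n + 1)) * alt_sum q n) sums
           (theta_J_bar 1 4 q * (1 + q * w_sum q (- (q ^ 2))))"
proof -
  let ?J = "theta_J_bar 1 4 q"
  define h where "h j k = (1 + q ^ (2 * j + 2 * k + 1)) * (q ^ (k choose 2) * (qpoch q q (2 * j + k) / qpoch q q k))" for j k
  define g where "g j k = (- 1) ^ j * (h j k - h (Suc j) k)" for j k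
  define t where "t n = (- 1) ^ n * (1 + q ^ (2 * n + 1)) * alt_sum q n" for n
  have t_eq: "t n = (\<Sum>k\<le>n. (- 1) ^ (n - k) * h (n - k) k)" for n
    unfolding t_def alt_sum_def sum_distrib_left
  proof (rule sum.cong[OF refl])
    fix k assume "k \<in> {..n}"
    hence "2 * (n - k) + k = 2 * n - k" "2 * (n - k) + 2 * k + 1 = 2 * n + 1" by auto
    moreover have "(- 1 :: complex) ^ (n - k) = (- 1) ^ n * (- 1) ^ k"
      using \<open>k \<in> {..n}\<close> by (auto simp: minus_one_power_iff)
    ultimately show "(- 1) ^ n * (1 + q ^ (2 * n + 1)) * ((- 1) ^ k * q ^ (k choose 2) * (qpoch q q (2 * n - k) / qpoch q q k))
         = (- 1) ^ (n - k) * h (n - k) k"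
      unfolding h_def by (simp only: mult_ac)
  qed
  obtain B where B: "B > 0" "\<And>m k. norm (q ^ (k choose 2) * (qpoch q q m / qpoch q q k)) \<le> B"
    by (rule term_bounded[OF q(1)]) blast
  have gB: "norm (g j k) \<le> 8 * B * norm q ^ (j + k)" for j k
  proof -
    \<comment> \<open>Lengthening the Pochhammer symbol by two multiplies it by
      \<open>(1 - y) (1 - y q)\<close>. The difference of neighbouring rows is thus divisible by
      \<open>y\<close>, which supplies the decay in both \<open>j\<close> and
      \<open>k\<close>.\<close>
    define y K where "y = q ^ (2 * j + k + 1)" and "K = q ^ k"
    have ny: "norm y \<le> norm q ^ (j + k)"
      unfolding y_def norm_power by (rule power_decreasing) (use q in auto)
    have q1: "norm q \<le> 1" using q(1) by simp
    have y1: "norm y \<le> 1" and K1: "norm K \<le> 1" and q21: "norm (q ^ 2) \<le> 1"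
      unfolding y_def K_def norm_power by (intro power_le_one norm_ge_zero q1)+
    have "h j k - h (Suc j) k = y * (K + 1 + q - y * q - K * q ^ 2 * ((1 - y) * (1 - y * q))) *
          (q ^ (k choose 2) * (qpoch q q (2 * j + k) / qpoch q q k))"
    proof -
      have e: "qpoch q q (2 * Suc j + k) = qpoch q q (2 * j + k) * ((1 - y) * (1 - y * q))"
        by (simp add: qpoch_Suc y_def mult_ac)
      have e': "q ^ (2 * j + 2 * k + 1) = y * K" "q ^ (2 * Suc j + 2 * k + 1) = y * K * q ^ 2"
        unfolding y_def K_def power_add[symmetric] by (rule arg_cong[where f = "(^) q"], simp)+
      have "(1 + y * K) * (C * (Q / R)) - (1 + y * K * q ^ 2) * (C * (Q * ((1 - y) * (1 - y * q)) / R)) =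
         y * (K + 1 + q - y * q - K * q ^ 2 * ((1 - y) * (1 - y * q))) * (C * (Q / R))" for C Q R
        by (simp add: algebra_simps diff_divide_distrib add_divide_distrib)
      thus ?thesis
        unfolding h_def e e' .
    qed
    \<comment> \<open>Four terms of norm at most 1, and a product of norm at most
      \<open>2 * 2\<close>.\<close>
    moreover have "norm (K + 1 + q - y * q - K * q ^ 2 * ((1 - y) * (1 - y * q))) \<le> 8"
    proof -
      have yq: "norm (y * q) \<le> 1"
        unfolding norm_mult by (intro mult_le_one y1 q1 norm_ge_zero)
      have d: "norm (1 - y) \<le> 2" "norm (1 - y * q) \<le> 2"
        using norm_triangle_ineq4[of 1 y] norm_triangle_ineq4[of 1 "y * q"] y1 yq by simp_all
      have "norm (K * q ^ 2 * ((1 - y) * (1 - y * q))) \<le> 1 * 1 * (2 * 2)"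
        unfolding norm_mult by (intro mult_mono K1 q21 d mult_nonneg_nonneg norm_ge_zero) auto
      moreover have "norm (K + 1 + q - y * q) \<le> 1 + 1 + 1 + 1"
        by (intro order_trans[OF norm_triangle_ineq4] add_mono yq order_trans[OF norm_triangle_ineq] K1 q1) simp
      ultimately show ?thesis
        using norm_triangle_ineq4[of "K + 1 + q - y * q" "K * q ^ 2 * ((1 - y) * (1 - y * q))"] by linarith
    qed
    ultimately have "norm (h j k - h (Suc j) k) \<le> norm q ^ (j + k) * 8 * B"
      unfolding norm_mult[of _ "_ * _"] norm_mult[of y]
      by (auto simp only: norm_mult[of "y * _"] norm_mult[of y] intro!: mult_mono ny B(2) mult_nonneg_nonneg zero_le_power norm_ge_zero)
    thus ?thesis by (simp add: g_def norm_mult norm_power mult_ac)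
  qed
  \<comment> \<open>The factor \<open>1 + q^(2j+1) (q^2)^k\<close> yields \<open>Phi\<close> at
    \<open>z = 1\<close> and \<open>z = q^2\<close>, with exactly the weight
    \<open>a = q^(2j+1)\<close> of the companion identity.\<close>
  have hs: "h j sums (2 * (?J * qpoch q (q ^ 2) j))" for j
  proof -
    let ?a = "q ^ (2 * j + 1)"
    have a: "norm ?a < 1"
      using q(1) by (simp add: norm_power norm_mult power_less_one_iff del: power_Suc power_add)
    have "(\<lambda>k. qpoch q q (2 * j) * (q ^ (k choose 2) * 1 ^ k * (qpoch ?a q k / qpoch q q k) +
             ?a * (q ^ (k choose 2) * (q ^ 2) ^ k * (qpoch ?a q k / qpoch q q k))))
           sums (qpoch q q (2 * j) * (Phi ?a 1 q + ?a * Phi ?a (q ^ 2) q))"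
      unfolding Phi_def by (intro sums_mult sums_add summable_sums summable_Phi q less_imp_le a)
    also have "(\<lambda>k. qpoch q q (2 * j) * (q ^ (k choose 2) * 1 ^ k * (qpoch ?a q k / qpoch q q k) +
             ?a * (q ^ (k choose 2) * (q ^ 2) ^ k * (qpoch ?a q k / qpoch q q k)))) = h j"
    proof
      fix k
      have e: "qpoch q q (2 * j + k) = qpoch q q (2 * j) * qpoch ?a q k"
        by (simp add: qpoch_add mult.commute)
      have e': "q ^ (2 * j + 2 * k + 1) = ?a * (q ^ 2) ^ k"
        unfolding power_mult[symmetric] power_add[symmetric] by (rule arg_cong[where f = "(^) q"]) simp
      have "A * (C * 1 ^ k * (Q / R) + a * (C * Z * (Q / R))) = (1 + a * Z) * (C * (A * Q / R))" for A C Q R Z a :: complex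
        by (simp add: algebra_simps add_divide_distrib)
      thus "qpoch q q (2 * j) * (q ^ (k choose 2) * 1 ^ k * (qpoch ?a q k / qpoch q q k) +
             ?a * (q ^ (k choose 2) * (q ^ 2) ^ k * (qpoch ?a q k / qpoch q q k))) = h j k"
        unfolding h_def e e' .
    qed
    also have "qpoch q q (2 * j) * (Phi ?a 1 q + ?a * Phi ?a (q ^ 2) q) =
       2 * (qpoch q q (2 * j) * (qpoch_inf (?a * q) (q ^ 2) * qpoch_inf (- q) q))"
      unfolding Lebesgue_companion[OF q(1) a] by (simp only: mult_ac)
    finally show ?thesis unfolding qpoch_mult_Lebesgue .
  qed
  have "(\<lambda>n. \<Sum>k\<le>n. g (n - k) k) sums (\<Sum>j. \<Sum>k. g j k)"
    by (rule diagonal_sums[OF norm_ge_zero q(1) gB])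
  \<comment> \<open>Diagonal \<open>n + 1\<close> has one entry more than diagonal \<open>n\<close>,
    namely \<open>k = n + 1\<close> in row \<open>j = 0\<close>; hence the correction
    \<open>h 0 (Suc n)\<close>.\<close>
  also have "(\<lambda>n. \<Sum>k\<le>n. g (n - k) k) = (\<lambda>n. t n + t (Suc n) - h 0 (Suc n))"
  proof
    fix n
    have "t (Suc n) = (\<Sum>k\<le>n. - ((- 1) ^ (n - k) * h (Suc (n - k)) k)) + h 0 (Suc n)"
      unfolding t_eq[of "Suc n"] by (simp add: Suc_diff_le)
    thus "(\<Sum>k\<le>n. g (n - k) k) = t n + t (Suc n) - h 0 (Suc n)"
      unfolding t_eq[of n] g_def by (simp add: sum_negf sum_subtractf algebra_simps)
  qed
  \<comment> \<open>Consecutive row sums differ by the factor \<open>1 - q^(2j+1)\<close>; their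
    difference carries \<open>q^(2j+1)\<close>, which moves the argument of \<open>w_sum\<close> to
    \<open>-q^2\<close>.\<close>
  also have "(\<lambda>j. \<Sum>k. g j k) = (\<lambda>j. 2 * ?J * q * (qpoch q (q ^ 2) j * (- (q ^ 2)) ^ j))"
  proof
    fix j
    have "g j sums ((- 1) ^ j * (2 * (?J * qpoch q (q ^ 2) j) - 2 * (?J * qpoch q (q ^ 2) (Suc j))))"
      unfolding g_def by (intro sums_mult sums_diff hs)
    hence "(\<Sum>k. g j k) = (- 1) ^ j * (2 * (?J * qpoch q (q ^ 2) j) - 2 * (?J * qpoch q (q ^ 2) (Suc j)))"
      by (rule sums_unique[symmetric])
    also have "\<dots> = 2 * ?J * q * (qpoch q (q ^ 2) j * (- (q ^ 2)) ^ j)"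
      by (simp add: qpoch_Suc power_minus[of "q ^ 2"] algebra_simps)
    finally show "(\<Sum>k. g j k) = 2 * ?J * q * (qpoch q (q ^ 2) j * (- (q ^ 2)) ^ j)" .
  qed
  also have "(\<Sum>j. 2 * ?J * q * (qpoch q (q ^ 2) j * (- (q ^ 2)) ^ j)) = 2 * ?J * q * w_sum q (- (q ^ 2))"
    unfolding w_sum_def by (intro suminf_mult summable_w_sum q) (use q2 in auto)
  finally have 1: "(\<lambda>n. t n + t (Suc n) - h 0 (Suc n)) sums (2 * ?J * q * w_sum q (- (q ^ 2)))" .
  have 2: "(\<lambda>n. h 0 (Suc n)) sums (2 * ?J - h 0 0)"
    using hs[of 0] by (subst sums_Suc_iff) simp
  have "(\<lambda>n. t n + t (Suc n)) sums (2 * ?J * q * w_sum q (- (q ^ 2)) + (2 * ?J - h 0 0))"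
    using sums_add[OF 1 2] by simp
  hence "t sums ((2 * ?J * q * w_sum q (- (q ^ 2)) + (2 * ?J - h 0 0) + t 0) / 2)"
    using lim unfolding t_def[symmetric] by (rule sums_add_consecutive)
  moreover have "t 0 = h 0 0" by (simp add: t_eq)
  hence "(2 * ?J * q * w_sum q (- (q ^ 2)) + (2 * ?J - h 0 0) + t 0) / 2 = ?J * (1 + q * w_sum q (- (q ^ 2)))"
    by (simp add: field_simps)
  ultimately show ?thesis by (simp only: t_def[abs_def])
qed


section \<open>Signed rows in base \<open>q^2\<close>, for \<open>mock_phi_bar_1\<close> and
  \<open>mock_phi_bar_0\<close>\<close>

lemma qpoch_mult_Lebesgue_signed:
  "qpoch (q ^ 2) (q ^ 2) m * (qpoch_inf (q ^ Suc m) q * qpoch_inf q (q ^ 2))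
     = theta_J 1 2 q * qpoch (- q) q m"
proof -
  have "qpoch_inf q q = qpoch q q m * qpoch_inf (q ^ Suc m) q"
    using qpoch_inf_split[OF q(1), of q m] by (simp add: mult.commute)
  thus ?thesis by (simp add: theta_J_1_2 qpoch_mult_minus[symmetric] mult_ac)
qed

text \<open>The signed companion at \<open>s = q^(m+1)\<close>: the part \<open>q^(m+1+2k)\<close>
  of the bracket moves the argument from \<open>-q\<close> to \<open>-q^3\<close> with weight
  \<open>s\<close>. Of \<open>(q^2;q^2)_m = (q;q)_m (-q;q)_m\<close> the first factor completes
  \<open>(q^(m+1);q)_\<infinity>\<close>. Even \<open>m\<close> serves
  \<open>mock_phi_bar_1\<close>, odd \<open>m\<close> serves \<open>mock_phi_bar_0\<close>, and
  \<open>m = 0\<close> gives a theta series.\<close>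

lemma signed_row_sums:
  "(\<lambda>k. (- 1) ^ k * q ^ k * (1 - q ^ (m + 1 + 2 * k)) *
          ((q ^ 2) ^ (k choose 2) * (qpoch (q ^ 2) (q ^ 2) (m + k) / qpoch (q ^ 2) (q ^ 2) k)))
     sums (theta_J 1 2 q * qpoch (- q) q m)"
proof -
  let ?s = "q ^ Suc m"
  have s: "norm ?s < 1"
    unfolding norm_power using q by (intro power_Suc_less_one) auto
  have s2: "norm (?s ^ 2) \<le> 1"
    by (rule less_imp_le[OF norm_power2_less_1[OF s]])
  let ?T = "\<lambda>z k. (q ^ 2) ^ (k choose 2) * z ^ k * (qpoch (?s ^ 2) (q ^ 2) k / qpoch (q ^ 2) (q ^ 2) k)"
  have "(\<lambda>k. qpoch (q ^ 2) (q ^ 2) m * (?T (- q) k - ?s * ?T (- (q ^ 3)) k))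
      sums (qpoch (q ^ 2) (q ^ 2) m * (Phi (?s ^ 2) (- q) (q ^ 2) - ?s * Phi (?s ^ 2) (- (q ^ 3)) (q ^ 2)))"
    unfolding Phi_def by (intro sums_mult sums_diff summable_sums summable_Phi q2 s2)
  also have "(\<lambda>k. qpoch (q ^ 2) (q ^ 2) m * (?T (- q) k - ?s * ?T (- (q ^ 3)) k)) =
     (\<lambda>k. (- 1) ^ k * q ^ k * (1 - q ^ (m + 1 + 2 * k)) *
          ((q ^ 2) ^ (k choose 2) * (qpoch (q ^ 2) (q ^ 2) (m + k) / qpoch (q ^ 2) (q ^ 2) k)))"
  proof
    fix k
    have "?s ^ 2 = (q ^ 2) ^ m * q ^ 2"
      by (simp add: power2_eq_square power_mult_distrib)
    hence a: "qpoch (q ^ 2) (q ^ 2) (m + k) = qpoch (q ^ 2) (q ^ 2) m * qpoch (?s ^ 2) (q ^ 2) k"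
      by (simp only: qpoch_add)
    have b: "(- q) ^ k = (- 1) ^ k * q ^ k"
      by (rule power_minus)
    have "(- (q ^ 3)) ^ k = (- 1) ^ k * q ^ (3 * k)"
      by (simp add: power_minus[of "q ^ 3"] power_mult)
    moreover have "3 * k = k + 2 * k" by simp
    ultimately have c: "(- (q ^ 3)) ^ k = (- 1) ^ k * (q ^ k * q ^ (2 * k))"
      by (simp only: power_add)
    have d: "q ^ (m + 1 + 2 * k) = ?s * q ^ (2 * k)"
      by (simp add: power_add)
    have "A * (C * (M * K) * (Q / R) - s * (C * (M * (K * L)) * (Q / R))) =
      M * K * (1 - s * L) * (C * (A * Q / R))" for A C M K L Q R s :: complex
      by (simp add: algebra_simps diff_divide_distrib)
    thus "qpoch (q ^ 2) (q ^ 2) m * (?T (- q) k - ?s * ?T (- (q ^ 3)) k) =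
        (- 1) ^ k * q ^ k * (1 - q ^ (m + 1 + 2 * k)) *
          ((q ^ 2) ^ (k choose 2) * (qpoch (q ^ 2) (q ^ 2) (m + k) / qpoch (q ^ 2) (q ^ 2) k))"
      unfolding a b c d .
  qed
  finally show ?thesis
    unfolding Lebesgue_signed[OF q(1) s] qpoch_mult_Lebesgue_signed .
qed

lemma phi_bar_1_alt_sums:
  "(\<lambda>n. q ^ n * (1 - q ^ (2 * n + 1)) * alt_sum (q ^ 2) n) sums (theta_J 1 2 q * mock_phi_bar_1 q)"
proof -
  define g where "g j k = q ^ j * ((- 1) ^ k * q ^ k * (1 - q ^ (2 * j + 1 + 2 * k)) *
     ((q ^ 2) ^ (k choose 2) * (qpoch (q ^ 2) (q ^ 2) (2 * j + k) / qpoch (q ^ 2) (q ^ 2) k)))" for j k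
  obtain B where B: "\<And>m k. norm ((q ^ 2) ^ (k choose 2) * (qpoch (q ^ 2) (q ^ 2) m / qpoch (q ^ 2) (q ^ 2) k)) \<le> B"
    by (rule term_bounded[OF q2]) blast
  have gB: "norm (g j k) \<le> 2 * B * norm q ^ (j + k)" for j k
  proof -
    have n: "norm (1 - q ^ (2 * j + 1 + 2 * k)) \<le> 2"
      by (rule order_trans[OF norm_triangle_ineq4])
         (use power_le_one[of "norm q" "2 * j + 1 + 2 * k"] q in \<open>simp add: norm_power del: power_Suc power_add\<close>)
    have "norm (g j k) = norm q ^ j * (norm q ^ k * norm (1 - q ^ (2 * j + 1 + 2 * k)) *
        norm ((q ^ 2) ^ (k choose 2) * (qpoch (q ^ 2) (q ^ 2) (2 * j + k) / qpoch (q ^ 2) (q ^ 2) k)))"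
      by (simp add: g_def norm_mult norm_power norm_divide)
    also have "\<dots> \<le> norm q ^ j * (norm q ^ k * 2 * B)"
      by (intro mult_mono B n order_refl mult_nonneg_nonneg zero_le_power norm_ge_zero) simp
    finally show ?thesis by (simp add: power_add mult_ac)
  qed
  have "(\<Sum>k\<le>n. g (n - k) k) = q ^ n * (1 - q ^ (2 * n + 1)) * alt_sum (q ^ 2) n" for n
    unfolding alt_sum_def sum_distrib_left
  proof (rule sum.cong[OF refl])
    fix k assume "k \<in> {..n}"
    hence e: "2 * (n - k) + k = 2 * n - k" "2 * (n - k) + 1 + 2 * k = 2 * n + 1" "n = n - k + k" by auto
    have "q ^ n = q ^ (n - k) * q ^ k" by (subst e(3)) (rule power_add)
    thus "g (n - k) k = q ^ n * (1 - q ^ (2 * n + 1)) * ((- 1) ^ k * (q ^ 2) ^ (k choose 2) *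
         (qpoch (q ^ 2) (q ^ 2) (2 * n - k) / qpoch (q ^ 2) (q ^ 2) k))"
      unfolding g_def e(1,2) by (simp only: mult_ac)
  qed
  moreover have "(\<Sum>k. g j k) = theta_J 1 2 q * (q ^ j * qpoch (- q) q (2 * j))" for j
    unfolding g_def using sums_unique[OF sums_mult[OF signed_row_sums[of "2 * j"], of "q ^ j"]]
    by (simp only: mult_ac)
  moreover have "summable (\<lambda>j. q ^ j * qpoch (- q) q (2 * j))"
  proof -
    obtain B where B: "\<And>a n. norm a \<le> 1 \<Longrightarrow> norm (qpoch a q n) \<le> B"
      by (rule qpoch_bounded[OF q(1)]) blast
    have "summable (\<lambda>j. norm q ^ j * B)"
      by (intro summable_mult2 summable_geometric) (use q in auto)
    thus ?thesis
      by (rule summable_comparison_test'[of _ 0])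
         (use B[of "- q"] q in \<open>auto simp: norm_mult norm_power intro!: mult_left_mono\<close>)
  qed
  hence "(\<Sum>j. theta_J 1 2 q * (q ^ j * qpoch (- q) q (2 * j))) = theta_J 1 2 q * mock_phi_bar_1 q"
    unfolding mock_phi_bar_1_def by (rule suminf_mult)
  ultimately show ?thesis
    using diagonal_sums[OF norm_ge_zero q(1) gB] by simp
qed

lemma phi_bar_0_odd_alt_sums:
  "(\<lambda>n. q ^ Suc n * (1 - q ^ (2 * n + 2)) * odd_alt_sum (q ^ 2) n) sums (theta_J 1 2 q * (q * mock_phi_bar_0 q))"
proof -
  \<comment> \<open>The unsimplified \<open>2 * j + 1 + 1 + 2 * k\<close> matches
    \<open>signed_row_sums\<close> at \<open>m = 2 * j + 1\<close>.\<close>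
  define g where "g j k = q ^ Suc j * ((- 1) ^ k * q ^ k * (1 - q ^ (2 * j + 1 + 1 + 2 * k)) *
     ((q ^ 2) ^ (k choose 2) * (qpoch (q ^ 2) (q ^ 2) (2 * j + 1 + k) / qpoch (q ^ 2) (q ^ 2) k)))" for j k
  obtain B where B: "\<And>m k. norm ((q ^ 2) ^ (k choose 2) * (qpoch (q ^ 2) (q ^ 2) m / qpoch (q ^ 2) (q ^ 2) k)) \<le> B"
    by (rule term_bounded[OF q2]) blast
  have gB: "norm (g j k) \<le> norm q * 2 * B * norm q ^ (j + k)" for j k
  proof -
    have n: "norm (1 - q ^ (2 * j + 1 + 1 + 2 * k)) \<le> 2"
      by (rule order_trans[OF norm_triangle_ineq4])
         (use power_le_one[of "norm q" "2 * j + 1 + 1 + 2 * k"] q in \<open>simp add: norm_power del: power_Suc power_add\<close>)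
    have "norm (g j k) = norm q ^ Suc j * (norm q ^ k * norm (1 - q ^ (2 * j + 1 + 1 + 2 * k)) *
        norm ((q ^ 2) ^ (k choose 2) * (qpoch (q ^ 2) (q ^ 2) (2 * j + 1 + k) / qpoch (q ^ 2) (q ^ 2) k)))"
      by (simp add: g_def norm_mult norm_power norm_divide)
    also have "\<dots> \<le> norm q ^ Suc j * (norm q ^ k * 2 * B)"
      by (intro mult_mono B n order_refl mult_nonneg_nonneg zero_le_power norm_ge_zero) simp
    finally show ?thesis by (simp add: power_add mult_ac)
  qed
  have "(\<Sum>k\<le>n. g (n - k) k) = q ^ Suc n * (1 - q ^ (2 * n + 2)) * odd_alt_sum (q ^ 2) n" for n
    unfolding odd_alt_sum_def sum_distrib_left
  proof (rule sum.cong[OF refl])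
    fix k assume "k \<in> {..n}"
    hence e: "2 * (n - k) + 1 + k = 2 * n + 1 - k" "2 * (n - k) + 1 + 1 + 2 * k = 2 * n + 2" "Suc n = Suc (n - k) + k" by auto
    have "q ^ Suc n = q ^ Suc (n - k) * q ^ k" by (subst e(3)) (rule power_add)
    thus "g (n - k) k = q ^ Suc n * (1 - q ^ (2 * n + 2)) * ((- 1) ^ k * (q ^ 2) ^ (k choose 2) *
         (qpoch (q ^ 2) (q ^ 2) (2 * n + 1 - k) / qpoch (q ^ 2) (q ^ 2) k))"
      unfolding g_def e(1,2) by (simp only: mult_ac)
  qed
  moreover have "(\<Sum>k. g j k) = theta_J 1 2 q * q * (q ^ j * qpoch (- q) q (2 * j + 1))" for j
    unfolding g_def using sums_unique[OF sums_mult[OF signed_row_sums[of "2 * j + 1"], of "q ^ Suc j"]]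
    by (simp only: power_Suc mult_ac)
  moreover have "summable (\<lambda>j. q ^ j * qpoch (- q) q (2 * j + 1))"
  proof -
    obtain B where B: "\<And>a n. norm a \<le> 1 \<Longrightarrow> norm (qpoch a q n) \<le> B"
      by (rule qpoch_bounded[OF q(1)]) blast
    have "summable (\<lambda>j. norm q ^ j * B)"
      by (intro summable_mult2 summable_geometric) (use q in auto)
    thus ?thesis
      by (rule summable_comparison_test'[of _ 0])
         (use B[of "- q"] q in \<open>auto simp: norm_mult norm_power intro!: mult_left_mono\<close>)
  qed
  hence "(\<Sum>j. theta_J 1 2 q * q * (q ^ j * qpoch (- q) q (2 * j + 1))) = theta_J 1 2 q * q * mock_phi_bar_0 q"
    unfolding mock_phi_bar_0_def by (rule suminf_mult)
  ultimately show ?thesis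
    using diagonal_sums[OF norm_ge_zero q(1) gB] by (simp add: mult.assoc)
qed

text \<open>Gauss's series for \<open>J_{1,2}\<close>, the sum of \<open>(-1)^n q^(n^2)\<close> over
  all integers. In \<open>signed_row_sums\<close> with \<open>m = 0\<close> the Pochhammer quotient
  is 1, and \<open>1 - q^(2k+1)\<close> leaves two neighbouring terms of the theta series.\<close>

lemma theta_J_1_2_sums: "(\<lambda>n. 2 * ((- 1) ^ Suc n * q ^ (Suc n ^ 2))) sums (theta_J 1 2 q - 1)"
proof -
  let ?e = "\<lambda>n. (- 1) ^ n * q ^ (n ^ 2)"
  have nz: "qpoch (q ^ 2) (q ^ 2) k \<noteq> 0" for k by (rule qpoch_self_neq_0[OF q2])
  have e: "(\<lambda>k. ?e k + ?e (Suc k)) sums theta_J 1 2 q"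
  proof -
    have "(- 1) ^ k * q ^ k * (1 - q ^ (0 + 1 + 2 * k)) *
          ((q ^ 2) ^ (k choose 2) * (qpoch (q ^ 2) (q ^ 2) (0 + k) / qpoch (q ^ 2) (q ^ 2) k))
        = ?e k + ?e (Suc k)" for k
    proof -
      have "k ^ 2 = k + 2 * (k choose 2)"
        by (induction k) (simp_all add: Suc_choose_two power2_eq_square binomial_eq_0)
      hence "q ^ (k ^ 2) = q ^ k * (q ^ 2) ^ (k choose 2)"
        by (simp only: power_add power_mult)
      moreover have "Suc k ^ 2 = k ^ 2 + (0 + 1 + 2 * k)"
        by (simp add: power2_eq_square)
      hence "q ^ (Suc k ^ 2) = q ^ (k ^ 2) * q ^ (0 + 1 + 2 * k)"
        by (simp only: power_add)
      ultimately show ?thesis using nz[of k] by (simp add: algebra_simps)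
    qed
    thus ?thesis using signed_row_sums[of 0] by (simp only: qpoch_0 mult_1_right)
  qed
  have "?e \<longlonglongrightarrow> 0"
  proof (rule Lim_null_comparison[OF always_eventually])
    show "\<forall>n. norm (?e n) \<le> norm q ^ n"
    proof
      fix n :: nat
      have "n \<le> n ^ 2" by (simp add: power2_eq_square)
      thus "norm (?e n) \<le> norm q ^ n"
        unfolding norm_mult norm_power using q(1) by (simp add: power_decreasing)
    qed
    show "(\<lambda>n. norm q ^ n) \<longlonglongrightarrow> 0"
      by (rule LIMSEQ_realpow_zero) (use q in auto)
  qed
  from sums_add_consecutive[OF e this] have "?e sums ((theta_J 1 2 q + 1) / 2)"
    by simp
  hence "(\<lambda>n. ?e (Suc n)) sums ((theta_J 1 2 q + 1) / 2 - 1)"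
    by (subst sums_Suc_iff) simp
  moreover have "2 * ((theta_J 1 2 q + 1) / 2 - 1) = theta_J 1 2 q - 1" by simp
  ultimately show ?thesis using sums_mult[of _ _ "2 :: complex"] by metis
qed

text \<open>For \<open>\<phi>\<^sub>0\<close>-bar, the double series given directly by \<open>alt_sum\<close> diverges. Splitting
  \<open>1 - q^(6n+3)\<close> and shifting the first part by one leaves \<open>odd_alt_sum\<close>, which belongs to the
  Bailey pair relative to \<open>a = 1\<close>, and a theta series.\<close>

lemma phi_bar_0_consecutive:
  defines "X \<equiv> \<lambda>n. q ^ (4 * n ^ 2 + n) * pent_sum (q ^ 2) n"
  shows "X (Suc n) - q ^ (6 * n + 3) * X n =
           q ^ Suc n * (1 - q ^ (2 * n + 2)) * odd_alt_sum (q ^ 2) n + 2 * ((- 1) ^ Suc n * q ^ (Suc n ^ 2))"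
proof -
  define y where "y = q ^ n"
  define e where "e = (- 1) ^ Suc n * q ^ (Suc n ^ 2)"
  \<comment> \<open>The exponent \<open>4 m^2 + m\<close> falls short of the normalising exponent in
    base \<open>q^2\<close> by \<open>m\<close>.\<close>
  have XU: "q ^ m * X m = alt_sum (q ^ 2) m" for m
  proof -
    have "alt_sum (q ^ 2) m = q ^ (2 * (2 * m ^ 2 + m)) * pent_sum (q ^ 2) m"
      using alt_sum_eq_pent_sum[OF q2, of m] q(2) unfolding power_mult by simp
    also have "2 * (2 * m ^ 2 + m) = m + (4 * m ^ 2 + m)" by simp
    finally show ?thesis by (simp only: X_def power_add mult.assoc)
  qed
  have c: "Suc n ^ 2 = Suc n + 2 * (Suc n choose 2)" for n
    by (induction n) (simp_all add: Suc_choose_two power2_eq_square binomial_eq_0)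
  have ce: "q * y * ((- 1) ^ Suc n * (q ^ 2) ^ (Suc n choose 2)) = e"
    unfolding e_def y_def c power_add by (simp add: power_mult)
  have p1: "q ^ Suc n = q * y" "q ^ (2 * n + 2) = q ^ 2 * y ^ 2" "(q ^ 2) ^ Suc n = q ^ 2 * y ^ 2"
    "(q ^ 2) ^ (2 * n + 1) = q ^ 2 * y ^ 4" "(q ^ 2) ^ (2 * n + 2) = q ^ 4 * y ^ 4"
    "(q ^ 2) ^ (4 * n + 3) = q ^ 6 * y ^ 8" "q ^ (6 * n + 3) = q ^ 3 * y ^ 6"
    unfolding y_def power_mult[symmetric] power_add[symmetric] power_Suc[symmetric]
    by (rule arg_cong[where f = "(^) q"], simp)+
  have "y \<noteq> 0" using q by (simp add: y_def)
  have "1 + q ^ 2 * y ^ 2 \<noteq> 0"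
    using one_plus_power_neq_0[OF q(1), of "2 * n + 2"] unfolding p1 by simp
  have "alt_sum (q ^ 2) (Suc n) = q ^ 6 * y ^ 8 * alt_sum (q ^ 2) n +
      q * y * (q * y * ((- 1) ^ Suc n * (q ^ 2) ^ (Suc n choose 2))) * (1 + q ^ 2 * y ^ 2)"
    unfolding alt_sum_Suc[OF q2] p1 by (simp add: power2_eq_square)
  hence R: "q * y * X (Suc n) = q * y * (q ^ 5 * y ^ 8 * X n + e * (1 + q ^ 2 * y ^ 2))"
    unfolding ce XU[symmetric] p1 y_def[symmetric] by algebra
  have "q * y * (alt_sum (q ^ 2) (Suc n) - q ^ 2 * y ^ 4 * alt_sum (q ^ 2) n) =
      q * y * (1 - q ^ 4 * y ^ 4) * odd_alt_sum (q ^ 2) n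
      + (1 + q ^ 2 * y ^ 2) * (q * y * ((- 1) ^ Suc n * (q ^ 2) ^ (Suc n choose 2)))"
    unfolding p1(4)[symmetric] alt_sum_diff[OF q2] unfolding p1 by (simp only: distrib_left mult_ac)
  hence D: "q * y * (q * y * X (Suc n) - q ^ 2 * y ^ 4 * (y * X n)) =
      q * y * (1 - q ^ 4 * y ^ 4) * odd_alt_sum (q ^ 2) n + (1 + q ^ 2 * y ^ 2) * e"
    unfolding ce XU[symmetric] p1 y_def[symmetric] .
  from R have R': "X (Suc n) = q ^ 5 * y ^ 8 * X n + e * (1 + q ^ 2 * y ^ 2)"
    using \<open>y \<noteq> 0\<close> q(2) by simp
  \<comment> \<open>Adding \<open>R'\<close> to \<open>D\<close> produces the common factor
    \<open>1 + q^2 y^2\<close> on both sides, and the two contributions of \<open>e\<close> combine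
    to \<open>2 e\<close>.\<close>
  have "(1 + q ^ 2 * y ^ 2) * (X (Suc n) - q ^ 3 * y ^ 6 * X n) =
    (1 + q ^ 2 * y ^ 2) * (q * y * (1 - q ^ 2 * y ^ 2) * odd_alt_sum (q ^ 2) n + 2 * e)"
    using D R' by algebra
  thus ?thesis
    using \<open>1 + q ^ 2 * y ^ 2 \<noteq> 0\<close> unfolding p1 e_def[symmetric] by simp
qed

text \<open>Separate summability of the two parts of \<open>1 - q^(6n+3)\<close> permits the shift
  by one. The theta series contributes \<open>J_{1,2} - 1\<close>, and the -1 cancels against the
  term \<open>X 0 = 1\<close> lost in the shift; this is the origin of the \<open>+ 1\<close> next
  to \<open>q * mock_phi_bar_0 q\<close>.\<close>

lemma phi_bar_0_sums:
  assumes "summable (\<lambda>n. q ^ (4 * n ^ 2 + n) * pent_sum (q ^ 2) n)"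
    and "summable (\<lambda>n. q ^ (4 * n ^ 2 + n) * q ^ (6 * n + 3) * pent_sum (q ^ 2) n)"
  shows "(\<lambda>n. q ^ (4 * n ^ 2 + n) * (1 - q ^ (6 * n + 3)) * pent_sum (q ^ 2) n) sums
           (theta_J 1 2 q * (q * mock_phi_bar_0 q + 1))"
proof -
  define X where "X n = q ^ (4 * n ^ 2 + n) * pent_sum (q ^ 2) n" for n
  define Y where "Y n = q ^ (6 * n + 3) * X n" for n
  have X: "summable X" using assms(1) by (simp add: X_def[abs_def])
  have Y: "summable Y" using assms(2) by (simp add: Y_def[abs_def] X_def mult_ac)
  have "(\<lambda>n. X (Suc n) - Y n) sums (theta_J 1 2 q * (q * mock_phi_bar_0 q) + (theta_J 1 2 q - 1))"
    unfolding Y_def X_def phi_bar_0_consecutive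
    by (intro sums_add phi_bar_0_odd_alt_sums theta_J_1_2_sums)
  moreover have "(\<lambda>n. X (Suc n) - Y n) sums (suminf X - X 0 - suminf Y)"
    by (intro sums_diff summable_sums Y) (subst sums_Suc_iff, simp add: summable_sums X)
  ultimately have "suminf X - X 0 - suminf Y = theta_J 1 2 q * (q * mock_phi_bar_0 q) + (theta_J 1 2 q - 1)"
    by (rule sums_unique2[symmetric])
  moreover have "X 0 = 1" by (simp add: X_def pent_sum_def)
  moreover have "(\<lambda>n. X n - Y n) sums (suminf X - suminf Y)"
    by (intro sums_diff summable_sums X Y)
  ultimately show ?thesis
    by (simp add: X_def Y_def algebra_simps)
qed

end

subsection \<open>Hecke-type double sums\<close>

lemma sg_eq_iff: "sg r = sg s \<longleftrightarrow> (r \<ge> 0 \<longleftrightarrow> s \<ge> 0)"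
  by (auto simp: sg_def)

text \<open>The signs of the two arguments cancel \<open>(-1)^(r+s)\<close>, so a Hecke term is
  \<open>sg r\<close> times a pure power of \<open>q\<close>.\<close>

lemma hecke_term_eq:
  fixes q :: complex
  assumes q: "q \<noteq> 0"
  shows "sg r * (- 1) powi (r + s) * (- (q ^ a)) powi r * (- (q ^ b)) powi s * q powi e
           = sg r * q powi (int a * r + int b * s + e)"
proof -
  have m: "(- (q ^ a)) powi r = (- 1) powi r * q powi (int a * r)" for a r
    using power_int_mult_distrib[of "- 1" "q ^ a" r] by (simp add: power_int_mult)
  have "(- 1 :: complex) powi (r + s) * (- 1) powi r * (- 1) powi s = 1"
    by (auto simp: power_int_add power_int_minus_one_mult_self mult_ac)
  thus ?thesis
    unfolding m by (simp add: power_int_add q mult_ac)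
qed

lemma triangular_exponent: "2 * (r * (r - 1) div 2) = r * (r - 1 :: int)"
  by (intro dvd_mult_div_cancel) simp

text \<open>The change of variables \<open>n = r + s\<close>, \<open>j = s - r\<close> turns
  \<open>2 n^2 - 3 j^2 / 2\<close> into \<open>r^2 / 2 + 7 r s + s^2 / 2\<close>, whence the
  parameters 1, 7, 1. Doubling both sides removes the integer divisions.\<close>

lemma hecke_even_exponent:
  fixes r s :: int
  shows "2 * (r + s) ^ 2 + (r + s) + (- 3 * (s - r) ^ 2 + (s - r)) div 2 =
     int 1 * r + int 2 * s + (1 * (r * (r - 1) div 2) + 7 * r * s + 1 * (s * (s - 1) div 2))"
proof -
  have "2 * (2 * (r + s) ^ 2 + (r + s) + (- 3 * (s - r) ^ 2 + (s - r)) div 2) =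
     2 * (int 1 * r + int 2 * s + (1 * (r * (r - 1) div 2) + 7 * r * s + 1 * (s * (s - 1) div 2)))"
    unfolding distrib_left pent_exponent using triangular_exponent[of r] triangular_exponent[of s]
    by (simp add: power2_eq_square algebra_simps)
  thus ?thesis by (rule mult_left_cancel[THEN iffD1, rotated]) simp
qed

text \<open>The same form at \<open>n = -(r + s + 1)\<close>; the shift changes the linear part and
  leaves the constant 1, which is the prefactor \<open>q\<close> of the second Hecke sum.\<close>

lemma hecke_odd_exponent:
  fixes r s :: int
  shows "2 * (- (r + s + 1)) ^ 2 + (- (r + s + 1)) + (- 3 * (s - r) ^ 2 + (s - r)) div 2 =
     1 + (int 3 * r + int 4 * s + (1 * (r * (r - 1) div 2) + 7 * r * s + 1 * (s * (s - 1) div 2)))"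
proof -
  have "2 * (2 * (- (r + s + 1)) ^ 2 + (- (r + s + 1)) + (- 3 * (s - r) ^ 2 + (s - r)) div 2) =
     2 * (1 + (int 3 * r + int 4 * s + (1 * (r * (r - 1) div 2) + 7 * r * s + 1 * (s * (s - 1) div 2))))"
    unfolding distrib_left pent_exponent using triangular_exponent[of r] triangular_exponent[of s]
    by (simp add: power2_eq_square algebra_simps)
  thus ?thesis by (rule mult_left_cancel[THEN iffD1, rotated]) simp
qed

context
  fixes q :: complex
  assumes q: "norm q < 1" "q \<noteq> 0"
begin

text \<open>The two Hecke sums are the parts of the cone sum with \<open>n + j\<close> even, where \<open>r = (n - j) / 2\<close>
  and \<open>s = (n + j) / 2\<close>, and with \<open>n + j\<close> odd, where the two half cones change roles.\<close>

lemma cone_sum_eq_hecke_f: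
  "cone_sum (F_phi q) =
     hecke_f 1 7 1 (- q) (- (q ^ 2)) q + q * hecke_f 1 7 1 (- (q ^ 3)) (- (q ^ 4)) q"
proof -
  define P N where "P = {(n :: int, j). n + j \<ge> 0 \<and> n - j \<ge> 0}" and "N = {(n :: int, j). n + j < 0 \<and> n - j < 0}"
  define A where "A = {(r, s). sg r = sg s}"
  \<comment> \<open>On the two half cones the sign of \<open>n + j\<close> alone tells them apart,
    so \<open>E\<close> turns the difference of two sums into one sum over
    \<open>P \<union> N\<close>.\<close>
  define E where "E = (\<lambda>(n, j). if n + j \<ge> 0 then F_phi q n j else - F_phi q n j)"
  have EP: "E summable_on P" "infsum E P = infsum (\<lambda>(n, j). F_phi q n j) P"
    using F_phi_cone_sums(1)[OF q]
    by (auto simp: E_def P_def intro!: infsum_cong elim!: summable_on_cong[THEN iffD1, rotated])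
  have "E summable_on N \<longleftrightarrow> (\<lambda>x. - (case x of (n, j) \<Rightarrow> F_phi q n j)) summable_on N"
    by (rule summable_on_cong) (auto simp: E_def N_def)
  hence EN: "E summable_on N"
    using F_phi_cone_sums(2)[OF q] by (simp add: N_def summable_on_uminus)
  have EN': "infsum E N = - infsum (\<lambda>(n, j). F_phi q n j) N"
    unfolding infsum_uminus[symmetric] by (rule infsum_cong) (auto simp: E_def N_def)
  have PN: "P \<inter> N = {}" by (auto simp: P_def N_def)
  have sE: "E summable_on (P \<union> N)"
    by (rule summable_on_Un_disjoint[OF EP(1) EN PN])
  have "cone_sum (F_phi q) = infsum E (P \<union> N)"
    using infsum_Un_disjoint[OF EP(1) EN PN] EP(2) EN' by (simp add: cone_sum_def P_def N_def)
  also have "P \<union> N = {x \<in> P \<union> N. even (fst x + snd x)} \<union> {x \<in> P \<union> N. odd (fst x + snd x)}"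
    by auto
  also have "infsum E \<dots> = infsum E {x \<in> P \<union> N. even (fst x + snd x)} + infsum E {x \<in> P \<union> N. odd (fst x + snd x)}"
    by (intro infsum_Un_disjoint summable_on_subset[OF sE]) auto
  also have "infsum E {x \<in> P \<union> N. even (fst x + snd x)} = hecke_f 1 7 1 (- q) (- (q ^ 2)) q"
    unfolding hecke_f_def
  proof (rule infsum_reindex_bij_witness[symmetric, of _ "\<lambda>(n, j). ((n - j) div 2, (n + j) div 2)" "\<lambda>(r, s). (r + s, s - r)"])
    fix x :: "int \<times> int" assume "x \<in> {(r, s). sg r = sg s}"
    then obtain r s where x: "x = (r, s)" "r \<ge> 0 \<longleftrightarrow> s \<ge> 0" by (auto simp: sg_eq_iff)
    have e: "r + s + (s - r) = s + s" by simp
    have "(- 1 :: complex) powi (r + s + (s - r)) = 1"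
      unfolding e by (subst power_int_add) (simp_all add: power_int_minus_one_mult_self)
    hence "F_phi q (r + s) (s - r) =
        q powi (int 1 * r + int 2 * s + (1 * (r * (r - 1) div 2) + 7 * r * s + 1 * (s * (s - 1) div 2)))"
      unfolding F_phi_def hecke_even_exponent by (simp only: mult_1_left)
    moreover have "E (r + s, s - r) = sg r * F_phi q (r + s) (s - r)"
      using x(2) by (auto simp: E_def sg_def)
    ultimately show "E (case x of (r, s) \<Rightarrow> (r + s, s - r)) = (case x of (r, s) \<Rightarrow>
        sg r * (- 1) powi (r + s) * (- q) powi r * (- (q ^ 2)) powi s *
        q powi (1 * (r * (r - 1) div 2) + 7 * r * s + 1 * (s * (s - 1) div 2)))"
      using hecke_term_eq[OF q(2), of r s 1 2] by (simp only: x(1) prod.case power_one_right)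
  qed (auto simp: P_def N_def sg_eq_iff, presburger+)
  also have "infsum E {x \<in> P \<union> N. odd (fst x + snd x)} = q * hecke_f 1 7 1 (- (q ^ 3)) (- (q ^ 4)) q"
    unfolding hecke_f_def infsum_cmult_right'[symmetric]
  \<comment> \<open>Here \<open>n + j = -2 r - 1\<close> and \<open>n - j = -2 s - 1\<close>, so
    nonnegative \<open>r\<close> and \<open>s\<close> land in \<open>N\<close>. The resulting sign
    reversal in \<open>E\<close> is undone by \<open>(-1)^(n+j) = -1\<close>.\<close>
  proof (rule infsum_reindex_bij_witness[symmetric, of _ "\<lambda>(n, j). ((- n - j - 1) div 2, (j - n - 1) div 2)" "\<lambda>(r, s). (- (r + s + 1), s - r)"])
    fix x :: "int \<times> int" assume "x \<in> {(r, s). sg r = sg s}"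
    then obtain r s where x: "x = (r, s)" "r \<ge> 0 \<longleftrightarrow> s \<ge> 0" by (auto simp: sg_eq_iff)
    have e: "- (r + s + 1) + (s - r) = (- r) + (- r) + (- 1)" by simp
    have "(- 1 :: complex) powi (- (r + s + 1) + (s - r)) = - 1"
      unfolding e by (subst power_int_add, simp, subst power_int_add, simp_all add: power_int_minus_one_mult_self)
    moreover have "q powi (1 + e) = q * q powi e" for e
      using q(2) by (simp add: power_int_add)
    ultimately have "F_phi q (- (r + s + 1)) (s - r) = - (q *
        q powi (int 3 * r + int 4 * s + (1 * (r * (r - 1) div 2) + 7 * r * s + 1 * (s * (s - 1) div 2))))"
      unfolding F_phi_def hecke_odd_exponent by (simp only: mult_minus_left mult_1_left)
    moreover have "E (- (r + s + 1), s - r) = - (sg r * F_phi q (- (r + s + 1)) (s - r))"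
      using x(2) by (auto simp: E_def sg_def)
    ultimately show "E (case x of (r, s) \<Rightarrow> (- (r + s + 1), s - r)) = q * (case x of (r, s) \<Rightarrow>
        sg r * (- 1) powi (r + s) * (- (q ^ 3)) powi r * (- (q ^ 4)) powi s *
        q powi (1 * (r * (r - 1) div 2) + 7 * r * s + 1 * (s * (s - 1) div 2)))"
      using hecke_term_eq[OF q(2), of r s 3 4]
      by (simp only: x(1) prod.case mult_minus_right minus_minus) (rule mult.left_commute)
  next
    fix b assume b: "b \<in> {x \<in> P \<union> N. odd (fst x + snd x)}"
    obtain n j where nj: "b = (n, j)" by (cases b)
    have "odd (n + j)" using b by (simp add: nj)
    then obtain k where k: "n + j = 2 * k + 1" by (rule oddE)
    have d: "(- n - j - 1) div 2 = - k - 1" "(j - n - 1) div 2 = j - k - 1"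
      using k by presburger+
    show "(case case b of (n, j) \<Rightarrow> ((- n - j - 1) div 2, (j - n - 1) div 2) of (r, s) \<Rightarrow> (- (r + s + 1), s - r)) = b"
      using k by (simp only: nj prod.case d) simp
    have "- k - 1 \<ge> 0 \<longleftrightarrow> j - k - 1 \<ge> 0"
      using b k unfolding nj P_def N_def by simp presburger
    thus "(case b of (n, j) \<Rightarrow> ((- n - j - 1) div 2, (j - n - 1) div 2)) \<in> {(r, s). sg r = sg s}"
      by (simp only: nj prod.case d mem_Collect_eq sg_eq_iff)
  next
    fix a assume "a \<in> {(r, s). sg r = sg s}"
    then obtain r s where a: "a = (r, s)" "r \<ge> 0 \<longleftrightarrow> s \<ge> 0" by (auto simp: sg_eq_iff)
    have d: "(- (- (r + s + 1)) - (s - r) - 1) div 2 = r" "((s - r) - (- (r + s + 1)) - 1) div 2 = s"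
      by presburger+
    show "(case case a of (r, s) \<Rightarrow> (- (r + s + 1), s - r) of (n, j) \<Rightarrow> ((- n - j - 1) div 2, (j - n - 1) div 2)) = a"
      by (simp only: a(1) prod.case d)
    show "(case a of (r, s) \<Rightarrow> (- (r + s + 1), s - r)) \<in> {x \<in> P \<union> N. odd (fst x + snd x)}"
      using a(2) unfolding a(1) P_def N_def by simp presburger
  qed
  finally show ?thesis .
qed

section \<open>Assembly of the four identities\<close>

lemma phi_sums:
  defines "t \<equiv> \<lambda>n. (- 1) ^ n * q ^ (2 * n ^ 2 + n) * (1 + q ^ (2 * n + 1)) * pent_sum q n"
  shows "t sums (theta_J_bar 1 4 q * mock_phi q)" "t sums cone_sum (F_phi q)"
proof -
  have "(\<Sum>j = - int n..int n. F_phi q (int n) j) - (\<Sum>j = - int n..int n. F_phi q (- int n - 1) j) = t n" for n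
    unfolding F_phi_row[OF q] t_def by (simp add: algebra_simps)
  thus *: "t sums cone_sum (F_phi q)"
    using F_phi_cone_sums(5)[OF q] by simp
  have "t = (\<lambda>n. (- 1) ^ n * (1 + q ^ (2 * n + 1)) * alt_sum q n)"
    by (rule ext) (simp add: t_def alt_sum_eq_pent_sum[OF q])
  \<comment> \<open>The null limit required by \<open>phi_alt_sums\<close> comes from the convergent
    cone series, which is why that half is established first.\<close>
  moreover have "t \<longlonglongrightarrow> 0"
    using * by (intro summable_LIMSEQ_zero sums_summable)
  ultimately show "t sums (theta_J_bar 1 4 q * mock_phi q)"
    using phi_alt_sums[OF q] by (simp add: mock_phi_eq[OF q(1)])
qed

lemma nu_sums:
  defines "t \<equiv> \<lambda>n. (- 1) ^ n * q ^ (2 * n ^ 2 + 2 * n) * pent_sum q n"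
  shows "t sums (theta_J_bar 1 4 q * mock_nu q)" "t sums (1 / 2 * cone_sum (F_nu q))"
proof -
  have "(\<Sum>j = - int n..int n. F_nu q (int n) j) - (\<Sum>j = - int n..int n. F_nu q (- int n - 1) j) = 2 * t n" for n
    unfolding F_nu_row[OF q] t_def by simp
  hence "(\<lambda>n. 1 / 2 * (2 * t n)) sums (1 / 2 * cone_sum (F_nu q))"
    using F_nu_cone_sums(5)[OF q] by (intro sums_mult) simp
  thus "t sums (1 / 2 * cone_sum (F_nu q))" by simp
  have "t n = (- 1) ^ n * q ^ n * alt_sum q n" for n
  proof -
    have "2 * n ^ 2 + 2 * n = n + (2 * n ^ 2 + n)" by simp
    thus ?thesis unfolding t_def alt_sum_eq_pent_sum[OF q] by (simp only: power_add mult.assoc)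
  qed
  hence "t = (\<lambda>n. (- 1) ^ n * q ^ n * alt_sum q n)" by (rule ext)
  thus "t sums (theta_J_bar 1 4 q * mock_nu q)"
    using nu_alt_sums[OF q] by (simp add: mock_nu_eq[OF q(1)])
qed

lemma phi_bar_0_cone_sums:
  defines "t \<equiv> \<lambda>n. q ^ (4 * n ^ 2 + n) * (1 - q ^ (6 * n + 3)) * pent_sum (q ^ 2) n"
  shows "t sums (theta_J 1 2 q * (q * mock_phi_bar_0 q + 1))" "t sums cone_sum (F_phi_bar_0 q)"
proof -
  have "(\<Sum>j = - int n..int n. F_phi_bar_0 q (int n) j) - (\<Sum>j = - int n..int n. F_phi_bar_0 q (- int n - 1) j) = t n" for n
    unfolding F_phi_bar_0_row[OF q] t_def by (simp add: algebra_simps)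
  thus "t sums cone_sum (F_phi_bar_0 q)"
    using F_phi_bar_0_cone_sums(5)[OF q] by simp
  show "t sums (theta_J 1 2 q * (q * mock_phi_bar_0 q + 1))"
    unfolding t_def
    \<comment> \<open>The rows of the two half cones are exactly the two parts of
      \<open>1 - q^(6n+3)\<close> that have to be summable separately.\<close>
    using F_phi_bar_0_cone_sums(3,4)[OF q] unfolding F_phi_bar_0_row[OF q] by (rule phi_bar_0_sums[OF q])
qed

lemma phi_bar_1_cone_sums:
  defines "t \<equiv> \<lambda>n. q ^ (4 * n ^ 2 + 3 * n) * (1 - q ^ (2 * n + 1)) * pent_sum (q ^ 2) n"
  shows "t sums (theta_J 1 2 q * mock_phi_bar_1 q)" "t sums cone_sum (F_phi_bar_1 q)"
proof -
  have "(\<Sum>j = - int n..int n. F_phi_bar_1 q (int n) j) - (\<Sum>j = - int n..int n. F_phi_bar_1 q (- int n - 1) j) = t n" for n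
    unfolding F_phi_bar_1_row[OF q] t_def by (simp add: algebra_simps)
  thus "t sums cone_sum (F_phi_bar_1 q)"
    using F_phi_bar_1_cone_sums(5)[OF q] by simp
  have "t n = q ^ n * (1 - q ^ (2 * n + 1)) * alt_sum (q ^ 2) n" for n
  proof -
    have "4 * n ^ 2 + 3 * n = n + 2 * (2 * n ^ 2 + n)" by simp
    hence "q ^ (4 * n ^ 2 + 3 * n) = q ^ n * (q ^ 2) ^ (2 * n ^ 2 + n)"
      by (simp only: power_add power_mult)
    moreover have "norm (q ^ 2) < 1" "q ^ 2 \<noteq> 0"
      using norm_power2_less_1[OF q(1)] q(2) by auto
    ultimately show ?thesis unfolding t_def by (simp add: alt_sum_eq_pent_sum)
  qed
  hence "t = (\<lambda>n. q ^ n * (1 - q ^ (2 * n + 1)) * alt_sum (q ^ 2) n)" by (rule ext)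
  thus "t sums (theta_J 1 2 q * mock_phi_bar_1 q)"
    using phi_bar_1_alt_sums[OF q] by simp
qed

end

theorem theorem1p7:
  fixes q :: complex
  assumes "q \<noteq> 0" and "norm q < 1"
  shows
    "(theta_J_bar 1 4 q * mock_phi q
        = (\<Sum>n::nat. (- 1) ^ n * q ^ (2 * n ^ 2 + n) * (1 + q ^ (2 * n + 1)) *
             (\<Sum>j = - int n..int n. (- 1) powi j * q powi ((- 3 * j ^ 2 + j) div 2)))
      \<and> theta_J_bar 1 4 q * mock_phi q
        = cone_sum (\<lambda>n j. (- 1) powi (n + j) * q powi (2 * n ^ 2 + n + (- 3 * j ^ 2 + j) div 2))
      \<and> theta_J_bar 1 4 q * mock_phi q
        = hecke_f 1 7 1 (- q) (- (q ^ 2)) q + q * hecke_f 1 7 1 (- (q ^ 3)) (- (q ^ 4)) q)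
   \<and> (theta_J_bar 1 4 q * mock_nu q
        = (\<Sum>n::nat. (- 1) ^ n * q ^ (2 * n ^ 2 + 2 * n) *
             (\<Sum>j = - int n..int n. (- 1) powi j * q powi ((- 3 * j ^ 2 + j) div 2)))
      \<and> theta_J_bar 1 4 q * mock_nu q
        = 1 / 2 * cone_sum (\<lambda>n j. (- 1) powi (n + j) *
             q powi (2 * n ^ 2 + 2 * n + (- 3 * j ^ 2 + j) div 2)))
   \<and> (theta_J 1 2 q * (q * mock_phi_bar_0 q + 1)
        = (\<Sum>n::nat. q ^ (4 * n ^ 2 + n) * (1 - q ^ (6 * n + 3)) *
             (\<Sum>j = - int n..int n. (- 1) powi j * q powi (- 3 * j ^ 2 - j)))
      \<and> theta_J 1 2 q * (q * mock_phi_bar_0 q + 1)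
        = cone_sum (\<lambda>n j. (- 1) powi j * q powi (4 * n ^ 2 + n - 3 * j ^ 2 - j)))
   \<and> (theta_J 1 2 q * mock_phi_bar_1 q
        = (\<Sum>n::nat. q ^ (4 * n ^ 2 + 3 * n) * (1 - q ^ (2 * n + 1)) *
             (\<Sum>j = - int n..int n. (- 1) powi j * q powi (- 3 * j ^ 2 - j)))
      \<and> theta_J 1 2 q * mock_phi_bar_1 q
        = cone_sum (\<lambda>n j. (- 1) powi j * q powi (4 * n ^ 2 + 3 * n - 3 * j ^ 2 - j)))"
proof -
  note q = assms(2,1)
  note F = F_phi_def[symmetric] F_nu_def[symmetric]
    F_phi_bar_0_def[symmetric] F_phi_bar_1_def[symmetric]
  note S = phi_sums[OF q] nu_sums[OF q] phi_bar_0_cone_sums[OF q] phi_bar_1_cone_sums[OF q]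
  show ?thesis
    unfolding F pent_sum_def[symmetric] pent_sum_square[OF q(2), symmetric]
    using S[THEN sums_unique] cone_sum_eq_hecke_f[OF q] by (intro conjI) (simp_all only:)
qed

end
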